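(* Let $N\ge1$ be an integer, let $a:[0,1]\to[0,+\infty)$ be continuous and not identically zero on any subinterval of $[0,1]$, and let $g:[0,+\infty)\to[0,+\infty)$ be continuous with $\lim_{s\to0^+}g(s)/s^N=0$. Consider $$\left((-v')^N\right)'=\lambda^NNr^{N-1}a(r)\left(v^N+g(v)\right),\ r\in(0,1),\qquad v'(0)=v(1)=0. \quad (\ast)$$ Then $(\lambda_1,0)$ is a bifurcation point of $(\ast)$, and the associated bifurcation branch $\mathcal C$ in $\mathbb R\times X^+$ whose closure contains $(\lambda_1,0)$ is either unbounded or contains a pair $(\overline\lambda,0)$, where $\overline\lambda$ is an eigenvalue of $$\left((-v')^N\right)'=\lambda^NNr^{N-1}a(r)v^N,\ r\in(0,1),\qquad v'(0)=v(1)=0, \quad (\ast\ast)$$ and $\overline\lambda\ne\lambda_1$.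
   Context: $X=C[0,1]$ with the sup norm and $X^+=\{v\in X:v(r)\ge0\}$ with the norm of $X$. Solutions of $(\ast)$ in $\mathbb R\times X^+$ are the pairs $(\lambda,v)$ with $v=\lambda T_gv$, where $T_gv(r)=\int_r^1\left(\int_0^sN\tau^{N-1}a(\tau)\left(v(\tau)^N+g(v(\tau))\right)d\tau\right)^{1/N}ds$. A number $\lambda>0$ is an eigenvalue of $(\ast\ast)$ if $(\ast\ast)$ has a solution $v\not\equiv0$; $\lambda_1$ denotes the first (smallest) eigenvalue of $(\ast\ast)$, which is positive and simple, with eigenfunctions (up to sign) positive in $(0,1)$ and concave on $[0,1]$. A point $(\lambda_1,0)$ is a bifurcation point if every neighborhood of it in $\mathbb R\times X^+$ contains solutions $(\lambda,v)$ of $(\ast)$ with $v\not\equiv0$. The bifurcation branch associated with $(\lambda_1,0)$ is the connected component containing $(\lambda_1,0)$ of the closure in $\mathbb R\times X^+$ of the set of solutions $(\lambda,v)$ with $v\not\equiv0$. *)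

theory Defs
  imports "HOL-Analysis.Analysis"
begin

text \<open>
  The space \<open>X = C[0,1]\<close> with the sup metric is the library's
  \<open>cfunspace (top_of_set {0..1}) euclidean_metric\<close>; its points are functions on the reals that
  are continuous on \<open>[0,1]\<close> and \<open>undefined\<close> elsewhere.  \<open>Xplus\<close> is the cone \<open>X\<^sup>+\<close> with the
  induced metric.
\<close>

definition Xplus :: "(real \<Rightarrow> real) metric" where
  "Xplus = submetric (cfunspace (top_of_set {0..1}) euclidean_metric) {v. \<forall>r\<in>{0..1}. 0 \<le> v r}"

definition zeroX :: "real \<Rightarrow> real" where
  "zeroX = (\<lambda>r\<in>{0..1}. 0)"

definition RXplus :: "(real \<times> (real \<Rightarrow> real)) metric" where
  "RXplus = prod_metric euclidean_metric Xplus"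

lemma mem_Xplus_iff:
  "v \<in> mspace Xplus \<longleftrightarrow>
     v \<in> extensional {0..1} \<and> continuous_on {0..1} v \<and> (\<forall>r\<in>{0..1}. 0 \<le> v r)"
  by (auto simp: Xplus_def intro!: compact_imp_bounded compact_continuous_image)

lemma mdist_Xplus_le_iff:
  assumes "u \<in> mspace Xplus" "v \<in> mspace Xplus"
  shows "mdist Xplus u v \<le> b \<longleftrightarrow> (\<forall>r\<in>{0..1}. \<bar>u r - v r\<bar> \<le> b)"
  using assms cfunspace_mdist_le[of u "top_of_set {0..1}" euclidean_metric v b]
  by (auto simp: Xplus_def dist_real_def)

lemma mspace_RXplus: "mspace RXplus = UNIV \<times> mspace Xplus"
  by (simp add: RXplus_def)

lemma zeroX_mem: "zeroX \<in> mspace Xplus"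
proof -
  have "continuous_on {0..1} zeroX"
    by (rule continuous_on_eq[of _ "\<lambda>_. 0"]) (auto simp: zeroX_def)
  then show ?thesis
    unfolding mem_Xplus_iff by (auto simp: zeroX_def)
qed

text \<open>
  Integrating \<open>((-v')\<^sup>N)' = \<lambda>\<^sup>N N r\<^sup>N\<^sup>-\<^sup>1 a(r) (v\<^sup>N + g(v))\<close>, \<open>v'(0) = v(1) = 0\<close>, twice gives
  \<open>v = \<lambda> T\<^sub>g v\<close>, which is what solving this problem in \<open>\<real> \<times> X\<^sup>+\<close> means.
\<close>

definition T_op :: "nat \<Rightarrow> (real \<Rightarrow> real) \<Rightarrow> (real \<Rightarrow> real) \<Rightarrow> (real \<Rightarrow> real) \<Rightarrow> real \<Rightarrow> real" where
  "T_op N a g v r =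
     integral {r..1} (\<lambda>s. root N (integral {0..s}
        (\<lambda>t. real N * t ^ (N - 1) * a t * (v t ^ N + g (v t)))))"

definition solutions ::
  "nat \<Rightarrow> (real \<Rightarrow> real) \<Rightarrow> (real \<Rightarrow> real) \<Rightarrow> (real \<times> (real \<Rightarrow> real)) set" where
  "solutions N a g =
     {(l, v). v \<in> mspace Xplus \<and> (\<forall>r\<in>{0..1}. v r = l * T_op N a g v r)}"

definition nontrivial_solutions ::
  "nat \<Rightarrow> (real \<Rightarrow> real) \<Rightarrow> (real \<Rightarrow> real) \<Rightarrow> (real \<times> (real \<Rightarrow> real)) set" where
  "nontrivial_solutions N a g = {(l, v) \<in> solutions N a g. \<exists>r\<in>{0..1}. v r \<noteq> 0}"

text \<open>
  Classical solutions \<open>v \<in> C\<^sup>1[0,1]\<close>, of arbitrary sign, of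
  \<open>((-v')\<^sup>N)' = \<lambda>\<^sup>N N r\<^sup>N\<^sup>-\<^sup>1 a(r) v\<^sup>N\<close> on \<open>(0,1)\<close> with \<open>v'(0) = v(1) = 0\<close>; derivatives of \<open>v\<close> at
  the end points are one-sided.
\<close>

definition solves_eigenproblem ::
  "nat \<Rightarrow> (real \<Rightarrow> real) \<Rightarrow> real \<Rightarrow> (real \<Rightarrow> real) \<Rightarrow> bool" where
  "solves_eigenproblem N a l v \<longleftrightarrow>
     (\<exists>v'. continuous_on {0..1} v' \<and>
           (\<forall>r\<in>{0..1}. (v has_real_derivative v' r) (at r within {0..1})) \<and>
           (\<forall>r\<in>{0<..<1}. ((\<lambda>s. (- v' s) ^ N) has_real_derivative
                            l ^ N * real N * r ^ (N - 1) * a r * v r ^ N) (at r)) \<and>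
           v' 0 = 0 \<and> v 1 = 0)"

definition eigenvalue :: "nat \<Rightarrow> (real \<Rightarrow> real) \<Rightarrow> real \<Rightarrow> bool" where
  "eigenvalue N a l \<longleftrightarrow>
     0 < l \<and> (\<exists>v. solves_eigenproblem N a l v \<and> (\<exists>r\<in>{0..1}. v r \<noteq> 0))"

definition lambda1 :: "nat \<Rightarrow> (real \<Rightarrow> real) \<Rightarrow> real" where
  "lambda1 N a = (LEAST l. eigenvalue N a l)"

definition bifurcation_point ::
  "nat \<Rightarrow> (real \<Rightarrow> real) \<Rightarrow> (real \<Rightarrow> real) \<Rightarrow> real \<Rightarrow> bool" where
  "bifurcation_point N a g l \<longleftrightarrow>
     (\<forall>U. openin (mtopology_of RXplus) U \<and> (l, zeroX) \<in> U \<longrightarrow>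
          U \<inter> nontrivial_solutions N a g \<noteq> {})"

definition branch ::
  "nat \<Rightarrow> (real \<Rightarrow> real) \<Rightarrow> (real \<Rightarrow> real) \<Rightarrow> real \<Rightarrow> (real \<times> (real \<Rightarrow> real)) set" where
  "branch N a g l =
     connected_component_of_set
       (subtopology (mtopology_of RXplus)
          (mtopology_of RXplus closure_of nontrivial_solutions N a g))
       (l, zeroX)"

definition bounded_RXplus :: "(real \<times> (real \<Rightarrow> real)) set \<Rightarrow> bool" where
  "bounded_RXplus S \<longleftrightarrow> Metric_space.mbounded (mspace RXplus) (mdist RXplus) S"

end

theory Submission
  imports Defs "HOL-Complex_Analysis.Great_Picard"
begin

text \<open>
  Solutions \<open>v = l T\<^sub>g v\<close> in the cone are decreasing and concave, so \<open>v = p w\<close> with \<open>p = v 0 = \<parallel>v\<parallel>\<close> and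
  \<open>w 0 = 1\<close>.  After division by \<open>p\<close> the equation for \<open>w\<close> extends continuously to \<open>p = 0\<close>, where it
  becomes the eigenvalue problem.  For \<open>p = 0\<close> only \<open>l = \<lambda>\<^sub>1\<close> is possible: if \<open>v\<close> is an eigenfunction
  of any sign for \<open>l'\<close>, then \<open>u = \<bar>v\<bar>\<close> satisfies \<open>u \<le> l' T\<^sub>0 u\<close>, and comparing \<open>u\<close> with a positive
  eigenfunction \<open>w\<close> for \<open>l\<close> yields \<open>l \<le> l'\<close>.

  No degree theory in function spaces is needed.  With a time delay in the integrand, the initial
  value problem \<open>w 0 = 1\<close> is solved explicitly and depends continuously on \<open>(p, l)\<close>, so that
  Brouwer's theorem in the plane produces solutions with \<open>w 1 = 0\<close> and \<open>p = P \<phi>(l, p w)\<close> for every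
  continuous \<open>\<phi>\<close> with values in \<open>[0, 1]\<close>; the Arzela-Ascoli theorem removes the delay.  If the
  component of \<open>(\<lambda>\<^sub>1, 0)\<close> among the solutions with \<open>\<parallel>v\<parallel> \<le> P\<close> avoided the sphere \<open>\<parallel>v\<parallel> = P\<close>, this compact
  set would split into a clopen part containing \<open>(\<lambda>\<^sub>1, 0)\<close> and a clopen part containing the sphere.
  A Urysohn function \<open>\<phi>\<close> equal to \<open>1\<close> on the former and \<open>0\<close> on the latter contradicts
  \<open>p = P \<phi>(l, p w)\<close>.  Hence the branch is always unbounded.
\<close>

subsection \<open>Iterated integrals with a root\<close>

text \<open>Integrating from 0 up to \<open>r\<close>, unlike \<open>T_op\<close>, makes the value
  at \<open>r\<close> depend only on \<open>f\<close> on \<open>[0, r]\<close>. This turns the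
  boundary value problem into an initial value problem.\<close>

definition iterated_root_integral :: "nat \<Rightarrow> (real \<Rightarrow> real) \<Rightarrow> real \<Rightarrow> real" where
  "iterated_root_integral N f r = integral {0..r} (\<lambda>s. root N (integral {0..s} f))"

locale continuous_density =
  fixes N :: nat and f :: "real \<Rightarrow> real"
  assumes N_pos: "0 < N"
    and f_cont: "continuous_on {0..1} f"
    and f_nonneg: "\<And>t. t \<in> {0..1} \<Longrightarrow> 0 \<le> f t"
begin

lemma f_integrable: "0 \<le> c \<Longrightarrow> d \<le> 1 \<Longrightarrow> f integrable_on {c..d}"
  by (rule integrable_continuous_real, rule continuous_on_subset[OF f_cont]) auto

lemma inner_nonneg: "s \<le> 1 \<Longrightarrow> 0 \<le> integral {0..s} f"
  by (rule integral_nonneg) (auto intro!: f_integrable f_nonneg)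

lemma inner_cont: "continuous_on {0..1} (\<lambda>s. integral {0..s} f)"
  by (rule indefinite_integral_continuous_1) (rule f_integrable, auto)

lemma root_inner_cont: "continuous_on {0..1} (\<lambda>s. root N (integral {0..s} f))"
  by (intro continuous_intros inner_cont)

lemma root_inner_integrable:
  "0 \<le> c \<Longrightarrow> d \<le> 1 \<Longrightarrow> (\<lambda>s. root N (integral {0..s} f)) integrable_on {c..d}"
  by (rule integrable_continuous_real, rule continuous_on_subset[OF root_inner_cont]) auto

lemma inner_mono: "0 \<le> s \<Longrightarrow> s \<le> s' \<Longrightarrow> s' \<le> 1 \<Longrightarrow> integral {0..s} f \<le> integral {0..s'} f"
  by (rule integral_subset_le) (auto intro!: f_integrable f_nonneg)

lemma root_inner_mono:
  "0 \<le> s \<Longrightarrow> s \<le> s' \<Longrightarrow> s' \<le> 1 \<Longrightarrow>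
    root N (integral {0..s} f) \<le> root N (integral {0..s'} f)"
  using inner_mono N_pos by simp

lemma root_inner_nonneg: "s \<le> 1 \<Longrightarrow> 0 \<le> root N (integral {0..s} f)"
  using inner_nonneg N_pos by simp

lemma diff_eq_integral:
  assumes "0 \<le> r" "r \<le> r'" "r' \<le> 1"
  shows "iterated_root_integral N f r' - iterated_root_integral N f r
    = integral {r..r'} (\<lambda>s. root N (integral {0..s} f))"
  using Henstock_Kurzweil_Integration.integral_combine[OF assms(1,2) root_inner_integrable[of 0 r']] assms
  by (simp add: iterated_root_integral_def)

lemma mono:
  assumes "0 \<le> r" "r \<le> r'" "r' \<le> 1"
  shows "iterated_root_integral N f r \<le> iterated_root_integral N f r'"
proof -
  have "0 \<le> integral {r..r'} (\<lambda>s. root N (integral {0..s} f))"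
    using assms by (intro integral_nonneg root_inner_integrable) (auto intro!: root_inner_nonneg)
  then show ?thesis using diff_eq_integral[OF assms] by linarith
qed

lemma at_0: "iterated_root_integral N f 0 = 0"
  by (simp add: iterated_root_integral_def)

lemma nonneg: "0 \<le> r \<Longrightarrow> r \<le> 1 \<Longrightarrow> 0 \<le> iterated_root_integral N f r"
  using mono[of 0 r] at_0 by simp

lemma deriv:
  assumes "r \<in> {0..1}"
  shows "(iterated_root_integral N f has_real_derivative root N (integral {0..r} f))
    (at r within {0..1})"
  unfolding iterated_root_integral_def[abs_def]
  by (rule integral_has_real_derivative[OF root_inner_cont assms])

lemma cont: "continuous_on {0..1} (iterated_root_integral N f)"
  by (rule DERIV_continuous_on[OF deriv])

lemma inner_deriv:
  assumes "r \<in> {0<..<1}"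
  shows "((\<lambda>s. integral {0..s} f) has_real_derivative f r) (at r)"
proof -
  have "((\<lambda>s. integral {0..s} f) has_real_derivative f r) (at r within {0..1})"
    by (rule integral_has_real_derivative[OF f_cont]) (use assms in auto)
  then show ?thesis
    using assms at_within_Icc_at[of 0 r 1] by simp
qed

text \<open>The slope \<open>root N (integral {0..s} f)\<close> increases with \<open>s\<close>, so
  the function is convex and, vanishing at 0, lies below its chord. The slope at \<open>r\<close>
  bounds the increment from above on \<open>[0, r]\<close> and from below on
  \<open>[r, 1]\<close>.\<close>

lemma convex_bound:
  assumes "0 \<le> r" "r \<le> 1"
  shows "iterated_root_integral N f r \<le> r * iterated_root_integral N f 1"
proof -
  let ?h = "root N (integral {0..r} f)"
  have "integral {0..r} (\<lambda>s. root N (integral {0..s} f)) \<le> integral {0..r} (\<lambda>_. ?h)"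
    using assms by (intro integral_le root_inner_integrable) (auto intro: root_inner_mono)
  then have 1: "iterated_root_integral N f r \<le> r * ?h"
    using assms by (simp add: iterated_root_integral_def)
  have "integral {r..1} (\<lambda>_. ?h) \<le> integral {r..1} (\<lambda>s. root N (integral {0..s} f))"
    using assms by (intro integral_le root_inner_integrable) (auto intro: root_inner_mono)
  then have 2: "(1 - r) * ?h \<le> iterated_root_integral N f 1 - iterated_root_integral N f r"
    using assms diff_eq_integral[of r 1] by simp
  have "(1 - r) * iterated_root_integral N f r \<le> (1 - r) * (r * ?h)"
    using 1 assms by (intro mult_left_mono) auto
  also have "\<dots> \<le> r * (iterated_root_integral N f 1 - iterated_root_integral N f r)"
    using mult_left_mono[OF 2, of r] assms by (simp add: algebra_simps)
  finally show ?thesis by (simp add: algebra_simps)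
qed

lemma lipschitz:
  assumes M: "\<And>t. t \<in> {0..1} \<Longrightarrow> f t \<le> M" and r: "r \<in> {0..1}" "r' \<in> {0..1}"
  shows "\<bar>iterated_root_integral N f r - iterated_root_integral N f r'\<bar> \<le> root N M * \<bar>r - r'\<bar>"
proof -
  have *: "iterated_root_integral N f r' - iterated_root_integral N f r \<le> root N M * (r' - r)"
    if "0 \<le> r" "r \<le> r'" "r' \<le> 1" for r r'
  proof -
    have "integral {0..s} f \<le> M" if "s \<in> {0..1}" for s
    proof -
      have "integral {0..s} f \<le> integral {0..s} (\<lambda>_. M)"
        using that by (intro integral_le f_integrable) (auto intro: M)
      also have "\<dots> = s * M" using that by simp
      also have "\<dots> \<le> 1 * M"
        using that M[of 0] f_nonneg[of 0] by (intro mult_right_mono) auto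
      finally show ?thesis by simp
    qed
    then have "integral {r..r'} (\<lambda>s. root N (integral {0..s} f)) \<le> integral {r..r'} (\<lambda>_. root N M)"
      using that N_pos by (intro integral_le root_inner_integrable) auto
    then show ?thesis using diff_eq_integral[OF that] that by (simp add: mult.commute)
  qed
  show ?thesis
    using *[of r r'] *[of r' r] mono[of r r'] mono[of r' r] r by (cases "r \<le> r'") auto
qed

end

text \<open>Increments rather than values are compared, because \<open>T_op\<close> at
  \<open>r\<close> is an increment over \<open>[r, 1]\<close>.\<close>

lemma iterated_root_integral_mono:
  assumes "continuous_density N f" "continuous_density N h"
    and "\<And>t. t \<in> {0..1} \<Longrightarrow> f t \<le> h t" and "0 \<le> r" "r \<le> r'" "r' \<le> 1"
  shows "iterated_root_integral N f r' - iterated_root_integral N f r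
    \<le> iterated_root_integral N h r' - iterated_root_integral N h r"
proof -
  interpret F: continuous_density N f by fact
  interpret H: continuous_density N h by fact
  have "integral {0..s} f \<le> integral {0..s} h" if "s \<le> 1" for s
    using that assms(3) by (intro integral_le F.f_integrable H.f_integrable) auto
  then have "integral {r..r'} (\<lambda>s. root N (integral {0..s} f))
    \<le> integral {r..r'} (\<lambda>s. root N (integral {0..s} h))"
    using assms(4-6) F.N_pos
    by (intro integral_le F.root_inner_integrable H.root_inner_integrable) auto
  then show ?thesis
    using F.diff_eq_integral H.diff_eq_integral assms(4-6) by simp
qed

lemma iterated_root_integral_scale:
  assumes "0 < N" "0 \<le> c"
  shows "iterated_root_integral N (\<lambda>t. c ^ N * f t) r = c * iterated_root_integral N f r"
  using assms by (simp add: iterated_root_integral_def real_root_mult real_root_power_cancel)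

lemma iterated_root_integral_cong:
  assumes "\<And>t. t \<in> {0..r} \<Longrightarrow> f t = h t"
  shows "iterated_root_integral N f r = iterated_root_integral N h r"
proof -
  have "integral {0..s} f = integral {0..s} h" if "s \<in> {0..r}" for s
    using that assms by (intro integral_cong) auto
  then show ?thesis
    unfolding iterated_root_integral_def by (intro integral_cong) simp
qed

section \<open>Stability of the iterated integral under uniform convergence\<close>

lemma uniform_limit_indefinite_integral:
  fixes f :: "nat \<Rightarrow> real \<Rightarrow> real"
  assumes lim: "uniform_limit {0..1} f h sequentially"
    and cont: "\<And>n. continuous_on {0..1} (f n)"
  shows "uniform_limit {0..1} (\<lambda>n s. integral {0..s} (f n)) (\<lambda>s. integral {0..s} h) sequentially"
  unfolding uniform_limit_iff
proof (intro allI impI)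
  fix e :: real assume "0 < e"
  have conth: "continuous_on {0..1} h"
    using cont by (intro uniform_limit_theorem[OF _ lim]) auto
  have "\<forall>\<^sub>F n in sequentially. \<forall>x\<in>{0..1}. dist (f n x) (h x) < e / 2"
    using lim \<open>0 < e\<close> unfolding uniform_limit_iff by (meson half_gt_zero)
  then show "\<forall>\<^sub>F n in sequentially. \<forall>s\<in>{0..1}. dist (integral {0..s} (f n)) (integral {0..s} h) < e"
  proof (eventually_elim, intro ballI)
    fix n and s :: real assume A: "\<forall>x\<in>{0..1}. dist (f n x) (h x) < e / 2" and s: "s \<in> {0..1}"
    have i: "f n integrable_on {0..s}" "h integrable_on {0..s}"
      using s by (auto intro!: integrable_continuous_real continuous_on_subset[OF cont]
          continuous_on_subset[OF conth])
    have "dist (integral {0..s} (f n)) (integral {0..s} h) = norm (integral {0..s} (\<lambda>x. f n x - h x))"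
      using i by (simp add: dist_norm Henstock_Kurzweil_Integration.integral_diff)
    also have "\<dots> \<le> integral {0..s} (\<lambda>_. e / 2)"
      using A s i by (intro integral_norm_bound_integral integrable_diff)
        (auto simp: dist_real_def intro!: less_imp_le)
    also have "\<dots> \<le> e / 2"
      using s \<open>0 < e\<close> by (auto intro!: mult_left_le_one_le)
    finally show "dist (integral {0..s} (f n)) (integral {0..s} h) < e"
      using \<open>0 < e\<close> by linarith
  qed
qed

text \<open>For \<open>N > 1\<close> the root is not Lipschitz at 0, so the limit passes through its
  uniform continuity on a compact interval that eventually contains all inner integrals.\<close>

lemma uniform_limit_iterated_root_integral:
  assumes lim: "uniform_limit {0..1} f h sequentially"
    and dens: "\<And>n. continuous_density N (f n)"
  shows "uniform_limit {0..1} (\<lambda>n. iterated_root_integral N (f n))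
    (iterated_root_integral N h) sequentially"
proof -
  have cont: "continuous_on {0..1} (f n)" for n
    using dens continuous_density.f_cont by blast
  have conth: "continuous_on {0..1} h"
    using cont by (intro uniform_limit_theorem[OF _ lim]) auto
  have inner: "uniform_limit {0..1} (\<lambda>n s. integral {0..s} (f n)) (\<lambda>s. integral {0..s} h) sequentially"
    by (rule uniform_limit_indefinite_integral[OF lim cont])
  have conti: "continuous_on {0..1} (\<lambda>s. integral {0..s} h)"
    by (rule indefinite_integral_continuous_1) (rule integrable_continuous_real[OF conth])
  obtain B where B: "\<And>s. s \<in> {0..1} \<Longrightarrow> \<bar>integral {0..s} h\<bar> \<le> B"
    using compact_imp_bounded[OF compact_continuous_image[OF conti compact_Icc]]
    unfolding bounded_real by (metis imageI)
  have "\<forall>\<^sub>F n in sequentially. \<forall>s\<in>{0..1}. dist (integral {0..s} (f n)) (integral {0..s} h) < 1"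
    using inner unfolding uniform_limit_iff by (meson zero_less_one)
  then have ev: "\<forall>\<^sub>F n in sequentially. \<forall>s\<in>{0..1}. integral {0..s} (f n) \<in> {- B - 1..B + 1}"
    by eventually_elim (use B in \<open>fastforce simp: dist_real_def abs_le_iff\<close>)
  have "uniformly_continuous_on {- B - 1..B + 1} (root N)"
    by (intro compact_uniformly_continuous continuous_intros compact_Icc)
  then have "uniform_limit {0..1} (\<lambda>n s. root N (integral {0..s} (f n)))
      (\<lambda>s. root N (integral {0..s} h)) sequentially"
    by (rule uniform_limit_compose_uniformly_continuous_on[OF inner _ ev closed_atLeastAtMost])
  then show ?thesis
    unfolding iterated_root_integral_def[abs_def]
    by (rule uniform_limit_indefinite_integral)
       (rule continuous_density.root_inner_cont[OF dens])
qed

subsection \<open>The rescaled problem and its delayed approximation\<close>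

text \<open>The truncation makes the nonlinearity bounded and defined for every profile, including
  iterates that leave \<open>[0, 1]\<close>. Normalised solutions take values in
  \<open>[0, 1]\<close> and are not altered by it (\<open>scaled_solution_range\<close>).\<close>

definition unit_clamp :: "real \<Rightarrow> real" where
  "unit_clamp x = max 0 (min 1 x)"

lemma unit_clamp_range: "0 \<le> unit_clamp x" "unit_clamp x \<le> 1"
  by (auto simp: unit_clamp_def)

lemma unit_clamp_id: "0 \<le> x \<Longrightarrow> x \<le> 1 \<Longrightarrow> unit_clamp x = x"
  by (auto simp: unit_clamp_def)

lemma unit_clamp_lipschitz: "\<bar>unit_clamp x - unit_clamp y\<bar> \<le> \<bar>x - y\<bar>"
  by (auto simp: unit_clamp_def max_def min_def)

lemma continuous_on_unit_clamp: "continuous_on S w \<Longrightarrow> continuous_on S (\<lambda>t. unit_clamp (w t))"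
  unfolding unit_clamp_def by (intro continuous_intros)

locale radial_problem =
  fixes N :: nat and a g :: "real \<Rightarrow> real"
  assumes N: "N \<ge> 1"
    and a_cont: "continuous_on {0..1} a"
    and a_nonneg: "\<And>r. r \<in> {0..1} \<Longrightarrow> 0 \<le> a r"
    and a_nonzero: "\<And>c d. 0 \<le> c \<Longrightarrow> c < d \<Longrightarrow> d \<le> 1 \<Longrightarrow> \<exists>r\<in>{c..d}. a r \<noteq> 0"
    and g_cont: "continuous_on {0..} g"
    and g_nonneg: "\<And>s. 0 \<le> s \<Longrightarrow> 0 \<le> g s"
    and g_lim: "((\<lambda>s. g s / s ^ N) \<longlongrightarrow> 0) (at_right 0)"
begin

text \<open>Division by zero gives \<open>quot 0 = 0\<close>, which is also the limit at 0, so
  \<open>quot\<close> is continuous on the closed half-line.\<close>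

definition quot :: "real \<Rightarrow> real" where
  "quot s = g s / s ^ N"

lemma quot_0: "quot 0 = 0"
  using N by (simp add: quot_def)

lemma quot_nonneg: "0 \<le> s \<Longrightarrow> 0 \<le> quot s"
  by (simp add: quot_def g_nonneg)

lemma quot_cont: "continuous_on {0..} quot"
  unfolding continuous_on_eq_continuous_within
proof
  fix s :: real assume s: "s \<in> {0..}"
  show "continuous (at s within {0..}) quot"
  proof (cases "s = 0")
    case True
    have "at 0 within {0..} = at_right (0::real)"
      by (metis at_within_Icc_at_right at_within_Ici_at_right zero_less_one)
    moreover have "(quot \<longlongrightarrow> 0) (at_right 0)"
      using g_lim by (simp add: quot_def[abs_def])
    ultimately show ?thesis
      using quot_0 unfolding continuous_within True by simp
  next
    case False
    have "continuous (at s within {0..}) g"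
      using g_cont s by (auto simp: continuous_on_eq_continuous_within)
    then show ?thesis
      unfolding quot_def[abs_def] using False by (intro continuous_intros) auto
  qed
qed

lemma g_0: "g 0 = 0"
proof -
  have "((\<lambda>s. g s / s ^ N * s ^ N) \<longlongrightarrow> 0 * 0 ^ N) (at_right 0)"
    by (intro tendsto_mult g_lim tendsto_power tendsto_ident_at)
  moreover have "\<forall>\<^sub>F s in at_right 0. g s / s ^ N * s ^ N = g s"
    by (auto simp: eventually_at intro!: exI[of _ 1])
  ultimately have "(g \<longlongrightarrow> 0) (at_right 0)"
    using tendsto_cong by fastforce
  moreover have "(g \<longlongrightarrow> g 0) (at_right 0)"
    using g_cont by (auto simp: continuous_on_def intro: tendsto_within_subset)
  ultimately show ?thesis
    using tendsto_unique[of "at_right (0::real)"] by fastforce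
qed

lemma power_add_g: "0 \<le> s \<Longrightarrow> s ^ N + g s = s ^ N * (1 + quot s)"
  using N g_0 by (cases "s = 0") (auto simp: quot_def field_simps)

definition weight :: "real \<Rightarrow> real" where
  "weight t = real N * t ^ (N - 1) * a t"

lemma weight_cont: "continuous_on {0..1} weight"
  unfolding weight_def[abs_def] by (intro continuous_intros a_cont)

lemma weight_nonneg: "t \<in> {0..1} \<Longrightarrow> 0 \<le> weight t"
  by (simp add: weight_def a_nonneg)

text \<open>For \<open>w t\<close> in \<open>[0, 1]\<close> this is the right-hand side for
  \<open>p * w\<close> divided by \<open>p ^ N\<close>. It stays meaningful at \<open>p = 0\<close>,
  where the homogeneous problem remains.\<close>

definition scaled_density :: "real \<Rightarrow> (real \<Rightarrow> real) \<Rightarrow> real \<Rightarrow> real" where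
  "scaled_density p w t = weight t * (unit_clamp (w t) ^ N * (1 + quot (p * unit_clamp (w t))))"

text \<open>Joint continuity in position, amplitude and profile value yields uniform bounds and
  uniform continuity on compact boxes.\<close>

lemma scaled_density_family_cont:
  "continuous_on ({0..1} \<times> {0..} \<times> {0..1})
    (\<lambda>z. weight (fst z) * (snd (snd z) ^ N * (1 + quot (fst (snd z) * snd (snd z)))))"
  by (intro continuous_intros continuous_on_compose2[OF weight_cont]
      continuous_on_compose2[OF quot_cont]) auto

lemma scaled_density_valid:
  assumes "0 \<le> p" "continuous_on {0..1} w"
  shows "continuous_density N (scaled_density p w)"
proof
  show "0 < N" using N by simp
  have "continuous_on {0..1} (\<lambda>t. (t, p, unit_clamp (w t)))"
    by (intro continuous_intros continuous_on_unit_clamp assms)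
  then have "continuous_on {0..1} (\<lambda>t. (\<lambda>z. weight (fst z) * (snd (snd z) ^ N *
      (1 + quot (fst (snd z) * snd (snd z))))) (t, p, unit_clamp (w t)))"
    using assms(1) unit_clamp_range by (intro continuous_on_compose2[OF scaled_density_family_cont]) auto
  then show "continuous_on {0..1} (scaled_density p w)"
    by (simp add: scaled_density_def[abs_def])
  show "0 \<le> scaled_density p w t" if "t \<in> {0..1}" for t
    using that assms(1) unit_clamp_range
    by (auto simp: scaled_density_def intro!: mult_nonneg_nonneg add_nonneg_nonneg weight_nonneg quot_nonneg)
qed

lemma scaled_density_bounded:
  obtains M where "0 \<le> M" "\<And>p w t. p \<in> {0..P} \<Longrightarrow> t \<in> {0..1} \<Longrightarrow> scaled_density p w t \<le> M"
proof -
  let ?F = "\<lambda>z. weight (fst z) * (snd (snd z) ^ N * (1 + quot (fst (snd z) * snd (snd z))))"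
  have "compact (?F ` ({0..1} \<times> {0..P} \<times> {0..1}))"
    by (intro compact_continuous_image continuous_on_subset[OF scaled_density_family_cont]
        compact_Times compact_Icc) auto
  then obtain M where M: "\<forall>x\<in>?F ` ({0..1} \<times> {0..P} \<times> {0..1}). \<bar>x\<bar> \<le> M"
    using compact_imp_bounded bounded_real by meson
  show thesis
  proof (rule that[of "max 0 M"])
    fix p t :: real and w :: "real \<Rightarrow> real" assume pt: "p \<in> {0..P}" "t \<in> {0..1}"
    then have "?F (t, p, unit_clamp (w t)) \<in> ?F ` ({0..1} \<times> {0..P} \<times> {0..1})"
      using unit_clamp_range by (intro imageI) auto
    then have "\<bar>?F (t, p, unit_clamp (w t))\<bar> \<le> M"
      using M by blast
    then show "scaled_density p w t \<le> max 0 M"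
      by (simp add: scaled_density_def)
  qed simp
qed

definition J :: "real \<Rightarrow> (real \<Rightarrow> real) \<Rightarrow> real \<Rightarrow> real" where
  "J p w = iterated_root_integral N (scaled_density p w)"

lemma J_uniform_limit:
  assumes p: "\<And>n. 0 \<le> p n" "p \<longlonglongrightarrow> p'"
    and w: "\<And>n. continuous_on {0..1} (w n)" "uniform_limit {0..1} w w' sequentially"
  shows "uniform_limit {0..1} (\<lambda>n. J (p n) (w n)) (J p' w') sequentially"
  unfolding J_def
proof (rule uniform_limit_iterated_root_integral[OF _ scaled_density_valid[OF p(1) w(1)]])
  let ?F = "\<lambda>z. weight (fst z) * (snd (snd z) ^ N * (1 + quot (fst (snd z) * snd (snd z))))"
  have "0 \<le> p'" using p by (intro LIMSEQ_le_const[of p]) auto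
  obtain P where P: "\<And>n. p n \<le> P"
    using convergent_imp_Bseq[of p] p(2) by (auto simp: convergent_def Bseq_def abs_le_iff)
  have unif: "uniformly_continuous_on ({0..1} \<times> {0..P} \<times> {0..1}) ?F"
    by (intro compact_uniformly_continuous continuous_on_subset[OF scaled_density_family_cont]
        compact_Times compact_Icc) auto
  have lim: "uniform_limit {0..1} (\<lambda>n t. (t, p n, unit_clamp (w n t)))
      (\<lambda>t. (t, p', unit_clamp (w' t))) sequentially"
    unfolding uniform_limit_iff
  proof (intro allI impI)
    fix e :: real assume "0 < e"
    have 1: "\<forall>\<^sub>F n in sequentially. dist (p n) p' < e / 2"
      using tendstoD[OF p(2), of "e / 2"] \<open>0 < e\<close> by simp
    have 2: "\<forall>\<^sub>F n in sequentially. \<forall>t\<in>{0..1}. dist (w n t) (w' t) < e / 2"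
      using w(2) \<open>0 < e\<close> unfolding uniform_limit_iff by (meson half_gt_zero)
    show "\<forall>\<^sub>F n in sequentially. \<forall>t\<in>{0..1}.
        dist (t, p n, unit_clamp (w n t)) (t, p', unit_clamp (w' t)) < e"
      using 1 2
    proof (eventually_elim, intro ballI)
      fix n and t :: real
      assume A: "dist (p n) p' < e / 2" "\<forall>t\<in>{0..1}. dist (w n t) (w' t) < e / 2" "t \<in> {0..1}"
      have "dist (t, p n, unit_clamp (w n t)) (t, p', unit_clamp (w' t))
        \<le> dist (p n) p' + dist (unit_clamp (w n t)) (unit_clamp (w' t))"
        by (simp add: dist_Pair_Pair sqrt_sum_squares_le_sum)
      also have "\<dots> < e / 2 + e / 2"
        using A unit_clamp_lipschitz[of "w n t" "w' t"] by (intro add_strict_mono) (fastforce simp: dist_real_def)+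
      finally show "dist (t, p n, unit_clamp (w n t)) (t, p', unit_clamp (w' t)) < e" by simp
    qed
  qed
  have "uniform_limit {0..1} (\<lambda>n t. ?F (t, p n, unit_clamp (w n t)))
      (\<lambda>t. ?F (t, p', unit_clamp (w' t))) sequentially"
    by (rule uniform_limit_compose_uniformly_continuous_on[OF lim unif])
       (use p(1) P unit_clamp_range in \<open>auto intro!: closed_Times always_eventually\<close>)
  then show "uniform_limit {0..1} (\<lambda>n. scaled_density (p n) (w n)) (scaled_density p' w') sequentially"
    by (simp add: scaled_density_def[abs_def])
qed

text \<open>With delay \<open>1 / n\<close> each iteration extends the solution by \<open>1 / n\<close>, so \<open>n\<close> iterations solve it.\<close>

definition delay :: "real \<Rightarrow> real \<Rightarrow> real" where
  "delay d t = max 0 (t - d)"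

lemma delay_range: "0 \<le> d \<Longrightarrow> t \<in> {0..1} \<Longrightarrow> delay d t \<in> {0..t}"
  by (auto simp: delay_def)

lemma delay_zero: "0 \<le> t \<Longrightarrow> delay 0 t = t"
  by (simp add: delay_def)

lemma continuous_on_delay:
  assumes "0 \<le> d" "continuous_on {0..1} w"
  shows "continuous_on {0..1} (\<lambda>t. w (delay d t))"
proof (rule continuous_on_compose2[OF assms(2)])
  show "continuous_on {0..1} (delay d)"
    unfolding delay_def[abs_def] by (intro continuous_intros)
  show "delay d ` {0..1} \<subseteq> {0..1}"
    using delay_range[OF assms(1)] by fastforce
qed

text \<open>A fixed point with \<open>d = 0\<close> solves the initial value problem
  \<open>w 0 = 1\<close>, \<open>w' 0 = 0\<close>. The number \<open>l\<close> stays free as a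
  shooting parameter for \<open>w 1 = 0\<close>.\<close>

definition step :: "real \<Rightarrow> real \<Rightarrow> real \<Rightarrow> (real \<Rightarrow> real) \<Rightarrow> real \<Rightarrow> real" where
  "step d p l w r = 1 - l * J p (\<lambda>t. w (delay d t)) r"

lemma J_cont: "0 \<le> p \<Longrightarrow> continuous_on {0..1} w \<Longrightarrow> continuous_on {0..1} (J p w)"
  unfolding J_def by (intro continuous_density.cont scaled_density_valid)

lemma J_0: "J p w 0 = 0"
  by (simp add: J_def iterated_root_integral_def)

lemma step_cont:
  "0 \<le> d \<Longrightarrow> 0 \<le> p \<Longrightarrow> continuous_on {0..1} w \<Longrightarrow> continuous_on {0..1} (step d p l w)"
  unfolding step_def[abs_def] by (intro continuous_intros J_cont continuous_on_delay)

text \<open>With a constant delay this gives continuous dependence of \<open>iter\<close> on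
  \<open>(p, l)\<close>; with delays tending to 0 it recovers the undelayed equation.\<close>

lemma step_uniform_limit:
  assumes d: "\<And>n. 0 \<le> d n" "d \<longlonglongrightarrow> d'" and p: "\<And>n. 0 \<le> p n" "p \<longlonglongrightarrow> p'" and l: "l \<longlonglongrightarrow> l'"
    and w: "\<And>n. continuous_on {0..1} (w n)" "uniform_limit {0..1} w w' sequentially"
  shows "uniform_limit {0..1} (\<lambda>n. step (d n) (p n) (l n) (w n)) (step d' p' l' w') sequentially"
proof -
  have d'0: "0 \<le> d'" using d by (intro LIMSEQ_le_const[of d]) auto
  have p'0: "0 \<le> p'" using p by (intro LIMSEQ_le_const[of p]) auto
  have w': "continuous_on {0..1} w'"
    using w by (intro uniform_limit_theorem[OF _ w(2)]) auto
  have "uniform_limit {0..1} (\<lambda>n t. w n (delay (d n) t)) (\<lambda>t. w' (delay d' t)) sequentially"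
    unfolding uniform_limit_iff
  proof (intro allI impI)
    fix e :: real assume "0 < e"
    \<comment> \<open>Uniform continuity of the limit profile absorbs the change of argument from
      \<open>delay (d n) t\<close> to \<open>delay d' t\<close>.\<close>
    have "uniformly_continuous_on {0..1} w'"
      by (rule compact_uniformly_continuous[OF w' compact_Icc])
    then obtain \<eta> where \<eta>: "0 < \<eta>"
      "\<And>s t. s \<in> {0..1} \<Longrightarrow> t \<in> {0..1} \<Longrightarrow> dist s t < \<eta> \<Longrightarrow> dist (w' s) (w' t) < e / 2"
      unfolding uniformly_continuous_on_def using \<open>0 < e\<close> by (metis half_gt_zero)
    have 1: "\<forall>\<^sub>F n in sequentially. dist (d n) d' < \<eta>"
      using d(2) \<eta>(1) by (simp add: tendsto_iff)
    have 2: "\<forall>\<^sub>F n in sequentially. \<forall>t\<in>{0..1}. dist (w n t) (w' t) < e / 2"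
      using w(2) \<open>0 < e\<close> unfolding uniform_limit_iff by (meson half_gt_zero)
    show "\<forall>\<^sub>F n in sequentially. \<forall>t\<in>{0..1}. dist (w n (delay (d n) t)) (w' (delay d' t)) < e"
      using 1 2
    proof (eventually_elim, intro ballI)
      fix n and t :: real
      assume A: "dist (d n) d' < \<eta>" "\<forall>t\<in>{0..1}. dist (w n t) (w' t) < e / 2" "t \<in> {0..1}"
      have *: "delay (d n) t \<in> {0..1}" "delay d' t \<in> {0..1}"
        using delay_range[OF d(1)[of n] A(3)] delay_range[OF d'0 A(3)] A(3) by auto
      have "dist (delay (d n) t) (delay d' t) < \<eta>"
        using A(1) by (auto simp: delay_def dist_real_def)
      then have "dist (w' (delay (d n) t)) (w' (delay d' t)) < e / 2"
        using \<eta>(2) * by blast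
      moreover have "dist (w n (delay (d n) t)) (w' (delay (d n) t)) < e / 2"
        using A(2) * by blast
      ultimately show "dist (w n (delay (d n) t)) (w' (delay d' t)) < e"
        by (metis dist_triangle_half_r dist_commute)
    qed
  qed
  then have J: "uniform_limit {0..1} (\<lambda>n. J (p n) (\<lambda>t. w n (delay (d n) t)))
      (J p' (\<lambda>t. w' (delay d' t))) sequentially"
    by (intro J_uniform_limit p continuous_on_delay d w)
  have "bounded (J p' (\<lambda>t. w' (delay d' t)) ` {0..1})"
    by (intro compact_imp_bounded compact_continuous_image J_cont continuous_on_delay d'0 w' p'0 compact_Icc)
  moreover have "uniform_limit {0..1} (\<lambda>n r. l n) (\<lambda>r. l') sequentially"
    using l by (auto simp: uniform_limit_iff tendsto_iff)
  moreover have "bounded ((\<lambda>r. l') ` {0..1::real})"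
    by (simp add: image_constant_conv)
  ultimately have "uniform_limit {0..1} (\<lambda>n r. l n * J (p n) (\<lambda>t. w n (delay (d n) t)) r)
      (\<lambda>r. l' * J p' (\<lambda>t. w' (delay d' t)) r) sequentially"
    by (intro uniform_lim_mult J)
  then show ?thesis
    unfolding step_def[abs_def] by (rule uniform_limit_minus[OF uniform_limit_const])
qed

primrec iter :: "real \<Rightarrow> real \<Rightarrow> real \<Rightarrow> nat \<Rightarrow> real \<Rightarrow> real" where
  "iter d p l 0 = (\<lambda>_. 1)"
| "iter d p l (Suc n) = step d p l (iter d p l n)"

lemma iter_cont: "0 \<le> d \<Longrightarrow> 0 \<le> p \<Longrightarrow> continuous_on {0..1} (iter d p l n)"
  by (induction n) (auto intro: step_cont)

lemma iter_uniform_limit: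
  assumes "0 \<le> d" "\<And>n. 0 \<le> p n" "p \<longlonglongrightarrow> p'" "l \<longlonglongrightarrow> l'"
  shows "uniform_limit {0..1} (\<lambda>k. iter d (p k) (l k) n) (iter d p' l' n) sequentially"
  using assms
  by (induction n) (auto intro!: step_uniform_limit iter_cont simp: uniform_limit_const)

text \<open>A step at \<open>r\<close> reads the profile only at arguments up to
  \<open>delay d r\<close>, so agreement of consecutive iterates up to \<open>n * d\<close>
  propagates to \<open>(n + 1) * d\<close>. At \<open>r = 0\<close> all iterates equal 1.\<close>

lemma iter_stable:
  assumes "0 \<le> d" "r \<in> {0..1}" "r \<le> real n * d"
  shows "iter d p l (Suc n) r = iter d p l n r"
  using assms
proof (induction n arbitrary: r)
  case 0
  then show ?case by (simp add: step_def J_0)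
next
  case (Suc n)
  have "scaled_density p (\<lambda>t. iter d p l (Suc n) (delay d t)) t = scaled_density p (\<lambda>t. iter d p l n (delay d t)) t"
    if "t \<in> {0..r}" for t
  proof -
    have "delay d t \<in> {0..1}" "delay d t \<le> real n * d"
      using that Suc.prems delay_range[of d t] by (auto simp: delay_def algebra_simps)
    then show ?thesis
      using Suc.IH[of "delay d t"] Suc.prems unfolding scaled_density_def by simp
  qed
  then show ?case
    unfolding iter.simps(2)[of d p l "Suc n"] iter.simps(2)[of d p l n] step_def J_def
    by (subst iterated_root_integral_cong) (auto simp: step_def J_def)
qed

lemma iter_fixed:
  assumes "0 < n" "r \<in> {0..1}"
  shows "iter (1 / n) p l n r = step (1 / n) p l (iter (1 / n) p l n) r"
  using iter_stable[of "1 / n" r n p l] assms by simp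

subsection \<open>Solutions with prescribed amplitude\<close>

lemma scaled_density_cong: "w t = w' t \<Longrightarrow> scaled_density p w t = scaled_density p w' t"
  by (simp add: scaled_density_def)

lemma J_cong: "(\<And>t. t \<in> {0..1} \<Longrightarrow> w t = w' t) \<Longrightarrow> r \<le> 1 \<Longrightarrow> J p w r = J p w' r"
  unfolding J_def by (rule iterated_root_integral_cong) (auto intro!: scaled_density_cong)

lemma step_0: "r \<in> {0..1} \<Longrightarrow> step 0 p l w r = 1 - l * J p w r"
  unfolding step_def by (subst J_cong[of _ w]) (auto simp: delay_zero)

text \<open>Concave solutions dominate \<open>1 - t\<close> and \<open>quot\<close> is nonnegative,
  so \<open>c0\<close> is a lower bound for \<open>J p w 1\<close> uniform in \<open>p\<close>, and
  \<open>1 / c0\<close> an upper bound for \<open>l\<close>.\<close>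

definition c0 :: real where
  "c0 = J 0 (\<lambda>t. 1 - t) 1"

lemma scaled_density_lower:
  assumes "0 \<le> p" "t \<in> {0..1}" "1 - t \<le> w t"
  shows "scaled_density 0 (\<lambda>t. 1 - t) t \<le> scaled_density p w t"
proof -
  have "unit_clamp (1 - t) \<le> unit_clamp (w t)"
    using assms by (auto simp: unit_clamp_def)
  moreover have "0 \<le> quot (p * unit_clamp (w t))"
    using assms unit_clamp_range by (intro quot_nonneg) simp
  ultimately have "unit_clamp (1 - t) ^ N * (1 + quot (0 * unit_clamp (1 - t)))
      \<le> unit_clamp (w t) ^ N * (1 + quot (p * unit_clamp (w t)))"
    using unit_clamp_range by (intro mult_mono power_mono) (auto simp: quot_0)
  then show ?thesis
    unfolding scaled_density_def by (intro mult_left_mono weight_nonneg assms)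
qed

lemma J_lower:
  assumes "0 \<le> p" "continuous_on {0..1} w" "\<And>t. t \<in> {0..1} \<Longrightarrow> 1 - t \<le> w t"
  shows "c0 \<le> J p w 1"
proof -
  have "J 0 (\<lambda>t. 1 - t) 1 - J 0 (\<lambda>t. 1 - t) 0 \<le> J p w 1 - J p w 0"
    unfolding J_def
    by (rule iterated_root_integral_mono) (auto intro!: scaled_density_valid assms scaled_density_lower continuous_intros)
  then show ?thesis by (simp add: c0_def J_0)
qed

lemma c0_pos: "0 < c0"
proof -
  interpret D: continuous_density N "scaled_density 0 (\<lambda>t. 1 - t)"
    by (rule scaled_density_valid) (auto intro!: continuous_intros)
  have "c0 \<noteq> 0"
  proof
    assume "c0 = 0"
    then have "integral {0..1} (\<lambda>s. root N (integral {0..s} (scaled_density 0 (\<lambda>t. 1 - t)))) = 0"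
      by (simp add: c0_def J_def iterated_root_integral_def)
    then have "\<forall>s\<in>{0..1}. root N (integral {0..s} (scaled_density 0 (\<lambda>t. 1 - t))) = 0"
      by (subst (asm) integral_eq_0_iff[OF D.root_inner_cont]) (auto intro: D.root_inner_nonneg)
    then have "integral {0..1} (scaled_density 0 (\<lambda>t. 1 - t)) = 0"
      using N by simp
    then have *: "\<forall>t\<in>{0..1}. scaled_density 0 (\<lambda>t. 1 - t) t = 0"
      by (subst (asm) integral_eq_0_iff[OF D.f_cont]) (auto intro: D.f_nonneg)
    \<comment> \<open>On this interval \<open>t ^ (N - 1)\<close> and \<open>(1 - t) ^ N\<close> are
      positive, so the density vanishes only where \<open>a\<close> does.\<close>
    obtain t where t: "t \<in> {1/4..1/2}" "a t \<noteq> 0"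
      using a_nonzero[of "1/4" "1/2"] by auto
    then show False
      using *[THEN bspec, of t] N by (auto simp: scaled_density_def weight_def quot_0 unit_clamp_def)
  qed
  moreover have "0 \<le> c0" unfolding c0_def J_def by (rule D.nonneg) auto
  ultimately show ?thesis by simp
qed

text \<open>Convexity of \<open>J\<close> makes \<open>w\<close> concave; since
  \<open>w 0 = 1\<close> and \<open>0 \<le> w 1\<close>, it lies above the chord from
  \<open>(0, 1)\<close> to \<open>(1, 0)\<close>.\<close>

lemma step_fixed_lower:
  assumes "0 \<le> d" "0 \<le> p" "0 \<le> l" "continuous_on {0..1} w"
    and eq: "\<And>r. r \<in> {0..1} \<Longrightarrow> w r = step d p l w r" and "0 \<le> w 1" and r: "r \<in> {0..1}"
  shows "1 - r \<le> w r"
proof -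
  let ?J = "J p (\<lambda>t. w (delay d t))"
  have "?J r \<le> r * ?J 1"
    unfolding J_def using r
    by (intro continuous_density.convex_bound scaled_density_valid assms continuous_on_delay) auto
  then have "l * ?J r \<le> l * (r * ?J 1)"
    using assms(3) by (rule mult_left_mono)
  also have "\<dots> = r * (1 - w 1)"
    using eq[of 1] by (simp add: step_def)
  also have "\<dots> \<le> r" using r assms(6) by (simp add: algebra_simps)
  finally show ?thesis using eq[OF r] by (simp add: step_def)
qed

text \<open>The delay moves arguments to the left, where \<open>1 - t\<close> is larger, so the
  delayed profile still dominates \<open>1 - t\<close> and \<open>J\<close> is at least
  \<open>c0\<close> at 1. Then \<open>0 \<le> w 1\<close> caps \<open>l\<close>.\<close>

lemma step_fixed_bound:
  assumes "0 \<le> d" "0 \<le> p" "0 \<le> l" "continuous_on {0..1} w"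
    and eq: "\<And>r. r \<in> {0..1} \<Longrightarrow> w r = step d p l w r" and "0 \<le> w 1"
  shows "l * c0 \<le> 1"
proof -
  have "1 - t \<le> w (delay d t)" if "t \<in> {0..1}" for t
    using step_fixed_lower[OF assms, of "delay d t"] delay_range[OF assms(1) that] that by auto
  then have "c0 \<le> J p (\<lambda>t. w (delay d t)) 1"
    by (intro J_lower continuous_on_delay assms)
  then have "l * c0 \<le> l * J p (\<lambda>t. w (delay d t)) 1"
    using assms(3) by (rule mult_left_mono)
  then show ?thesis using eq[of 1] assms(6) by (simp add: step_def)
qed

text \<open>The pairs \<open>(p, l)\<close> lie in a compact rectangle and the profiles share a
  Lipschitz constant, so Arzela-Ascoli applies. It serves twice: to remove the delay, and with zero
  delay to show that the set of solutions of bounded amplitude is compact.\<close>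

lemma step_fixed_compact:
  assumes d: "\<And>n. 0 \<le> d n" "d \<longlonglongrightarrow> 0" and p: "\<And>n::nat. p n \<in> {0..P}" and l: "\<And>n. l n \<in> {0..L}"
    and w: "\<And>n. continuous_on {0..1} (w n)"
    and eq: "\<And>n r. r \<in> {0..1} \<Longrightarrow> w n r = step (d n) (p n) (l n) (w n) r"
  obtains k p' l' w' where "strict_mono k" "(\<lambda>n. p (k n)) \<longlonglongrightarrow> p'" "(\<lambda>n. l (k n)) \<longlonglongrightarrow> l'"
    "uniform_limit {0..1} (\<lambda>n. w (k n)) w' sequentially" "continuous_on {0..1} w'"
    "p' \<in> {0..P}" "l' \<in> {0..L}"
    "\<And>r. r \<in> {0..1} \<Longrightarrow> w' r = step 0 p' l' w' r"
proof -
  have "seq_compact ({0..P} \<times> {0..L})"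
    by (intro compact_imp_seq_compact compact_Times compact_Icc)
  then obtain z k1 where z: "z \<in> {0..P} \<times> {0..L}" "strict_mono (k1 :: nat \<Rightarrow> nat)"
      "((\<lambda>n. (p n, l n)) \<circ> k1) \<longlonglongrightarrow> z"
    unfolding seq_compact_def using p l by (auto dest!: spec[of _ "\<lambda>n. (p n, l n)"])
  have p1: "(\<lambda>n. p (k1 n)) \<longlonglongrightarrow> fst z" and l1: "(\<lambda>n. l (k1 n)) \<longlonglongrightarrow> snd z"
    using tendsto_fst[OF z(3)] tendsto_snd[OF z(3)] by (simp_all add: o_def)
  obtain M where M: "0 \<le> M" "\<And>p w t. p \<in> {0..P} \<Longrightarrow> t \<in> {0..1} \<Longrightarrow> scaled_density p w t \<le> M"
    by (rule scaled_density_bounded[of P]) blast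
  \<comment> \<open>The added 1 keeps \<open>B\<close> positive even if \<open>L * root N M\<close>
    is 0, so that \<open>e / B\<close> is a valid modulus of continuity.\<close>
  define B where "B = L * root N M + 1"
  have L0: "0 \<le> L" using l[of 0] by auto
  have B: "0 < B" unfolding B_def using N M(1) L0 by (intro add_nonneg_pos mult_nonneg_nonneg) auto
  have lip: "\<bar>w n x - w n y\<bar> \<le> B * \<bar>x - y\<bar>" if "x \<in> {0..1}" "y \<in> {0..1}" for n x y
  proof -
    let ?J = "J (p n) (\<lambda>t. w n (delay (d n) t))"
    have "\<bar>?J x - ?J y\<bar> \<le> root N M * \<bar>x - y\<bar>"
      unfolding J_def
      by (rule continuous_density.lipschitz[OF scaled_density_valid])
        (use p[of n] that in \<open>auto intro!: M(2) continuous_on_delay d w\<close>)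
    then have "l n * \<bar>?J x - ?J y\<bar> \<le> L * (root N M * \<bar>x - y\<bar>)"
      using l[of n] by (intro mult_mono) auto
    moreover have "\<bar>w n x - w n y\<bar> = \<bar>- (l n * (?J x - ?J y))\<bar>"
      using eq[of x n] eq[of y n] that unfolding step_def by (simp add: algebra_simps)
    moreover have "\<bar>- (l n * (?J x - ?J y))\<bar> = l n * \<bar>?J x - ?J y\<bar>"
      using l[of n] by (simp add: abs_mult)
    ultimately show ?thesis
      unfolding B_def by (simp add: algebra_simps)
  qed
  have w0: "w n 0 = 1" for n
    using eq[of 0 n] by (simp add: step_def J_0)
  obtain w' k2 where w': "continuous_on {0..1} w'" "strict_mono (k2 :: nat \<Rightarrow> nat)"
    "\<And>e. 0 < e \<Longrightarrow> \<exists>n0. \<forall>n x. n \<ge> n0 \<and> x \<in> {0..1} \<longrightarrow> norm (w (k1 (k2 n)) x - w' x) < e"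
  proof (rule Arzela_Ascoli[of "{0..1::real}" "\<lambda>n. w (k1 n)" "B + 1"])
    show "norm (w (k1 n) x) \<le> B + 1" if "x \<in> {0..1}" for n x
    proof -
      have "\<bar>w (k1 n) x - w (k1 n) 0\<bar> \<le> B * \<bar>x - 0\<bar>" by (rule lip) (use that in auto)
      also have "\<dots> \<le> B" using that B by simp
      finally show ?thesis using w0[of "k1 n"] by simp
    qed
    show "\<exists>d>0. \<forall>n y. y \<in> {0..1} \<and> norm (x - y) < d \<longrightarrow> norm (w (k1 n) x - w (k1 n) y) < e"
      if "x \<in> {0..1}" "0 < e" for x e
    proof (intro exI[of _ "e / B"] conjI allI impI)
      fix n y assume y: "y \<in> {0..1} \<and> norm (x - y) < e / B"
      then have "B * \<bar>x - y\<bar> < e" using B by (simp add: field_simps)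
      then show "norm (w (k1 n) x - w (k1 n) y) < e"
        using lip[of x y "k1 n"] that y by simp
    qed (use B that in simp)
  qed auto
  have unif: "uniform_limit {0..1} (\<lambda>n. w (k1 (k2 n))) w' sequentially"
    unfolding uniform_limit_sequentially_iff using w'(3) by (fastforce simp: dist_norm)
  have k: "strict_mono (k1 \<circ> k2)" using z(2) w'(2) by (rule strict_mono_o)
  have p2: "(\<lambda>n. p (k1 (k2 n))) \<longlonglongrightarrow> fst z" and l2: "(\<lambda>n. l (k1 (k2 n))) \<longlonglongrightarrow> snd z"
    using LIMSEQ_subseq_LIMSEQ[OF p1 w'(2)] LIMSEQ_subseq_LIMSEQ[OF l1 w'(2)] by (simp_all add: o_def)
  have d2: "(\<lambda>n. d (k1 (k2 n))) \<longlonglongrightarrow> 0"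
    using LIMSEQ_subseq_LIMSEQ[OF d(2) k] by (simp add: o_def)
  have lim_step: "uniform_limit {0..1} (\<lambda>n. step (d (k1 (k2 n))) (p (k1 (k2 n))) (l (k1 (k2 n))) (w (k1 (k2 n))))
      (step 0 (fst z) (snd z) w') sequentially"
    by (rule step_uniform_limit[OF d(1) d2 _ p2 l2 w unif]) (use p in auto)
  have "w' r = step 0 (fst z) (snd z) w' r" if "r \<in> {0..1}" for r
    using tendsto_uniform_limitI[OF unif that] tendsto_uniform_limitI[OF lim_step that]
    unfolding eq[OF that, symmetric] by (rule LIMSEQ_unique)
  then show thesis
    using that[of "k1 \<circ> k2" "fst z" "snd z" w'] k p2 l2 unif w'(1) z(1)
    by (auto simp: o_def)
qed

section \<open>Normalised solutions as points of the product space\<close>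

definition scaled_solution :: "real \<Rightarrow> real \<Rightarrow> (real \<Rightarrow> real) \<Rightarrow> bool" where
  "scaled_solution p l w \<longleftrightarrow> 0 \<le> p \<and> 0 \<le> l \<and> continuous_on {0..1} w \<and>
    (\<forall>r\<in>{0..1}. w r = step 0 p l w r) \<and> w 1 = 0"

text \<open>The clamp keeps delayed iterates, which may become negative, inside the cone. At
  \<open>p = 0\<close> every profile is sent to \<open>(l, zeroX)\<close>.\<close>

definition emb :: "real \<Rightarrow> real \<Rightarrow> (real \<Rightarrow> real) \<Rightarrow> real \<times> (real \<Rightarrow> real)" where
  "emb p l w = (l, \<lambda>r\<in>{0..1}. p * unit_clamp (w r))"

lemma emb_mem:
  assumes "0 \<le> p" "continuous_on {0..1} w"
  shows "emb p l w \<in> mspace RXplus"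
proof -
  have "continuous_on {0..1} (\<lambda>r. p * unit_clamp (w r))"
    by (intro continuous_intros continuous_on_unit_clamp assms)
  then have "continuous_on {0..1} (\<lambda>r\<in>{0..1}. p * unit_clamp (w r))"
    by (rule continuous_on_eq) simp
  then show ?thesis
    using assms(1) unit_clamp_range by (simp add: emb_def mspace_RXplus mem_Xplus_iff)
qed

lemma emb_limit:
  assumes p: "\<And>n. 0 \<le> p n" "p \<longlonglongrightarrow> p'" and l: "l \<longlonglongrightarrow> l'"
    and w: "\<And>n. continuous_on {0..1} (w n)" "uniform_limit {0..1} w w' sequentially"
  shows "limitin (mtopology_of RXplus) (\<lambda>n. emb (p n) (l n) (w n)) (emb p' l' w') sequentially"
proof -
  have p'0: "0 \<le> p'" using p by (intro LIMSEQ_le_const[of p]) auto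
  have w': "continuous_on {0..1} w'"
    using w by (intro uniform_limit_theorem[OF _ w(2)]) auto
  have mem: "snd (emb (p n) (l n) (w n)) \<in> mspace Xplus" "snd (emb p' l' w') \<in> mspace Xplus" for n
    using emb_mem[OF p(1) w(1), of n "l n" n] emb_mem[OF p'0 w', of l']
    by (auto simp: mspace_RXplus mem_Times_iff)
  have "\<forall>\<^sub>F n in sequentially.
      mdist Xplus (snd (emb (p n) (l n) (w n))) (snd (emb p' l' w')) < e" if "0 < e" for e
  proof -
    \<comment> \<open>The error splits into an amplitude part of at most \<open>e'\<close> and a
      profile part of at most \<open>p' * e'\<close>, together at most \<open>e / 2\<close>.\<close>
    define e' where "e' = e / (2 * (p' + 2))"
    have e': "0 < e'" using that p'0 by (simp add: e'_def)
    have "\<forall>\<^sub>F n in sequentially. \<forall>t\<in>{0..1}. dist (w n t) (w' t) < e'"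
      using w(2) e' unfolding uniform_limit_iff by blast
    moreover have "\<forall>\<^sub>F n in sequentially. dist (p n) p' < e'"
      using tendstoD[OF p(2) e'] .
    ultimately show ?thesis
    proof eventually_elim
      case (elim n)
      have "\<bar>p n * unit_clamp (w n r) - p' * unit_clamp (w' r)\<bar> \<le> e / 2" if r: "r \<in> {0..1}" for r
      proof -
        have "p n * unit_clamp (w n r) - p' * unit_clamp (w' r)
          = (p n - p') * unit_clamp (w n r) + p' * (unit_clamp (w n r) - unit_clamp (w' r))"
          by (simp add: algebra_simps)
        also have "\<bar>\<dots>\<bar> \<le> \<bar>p n - p'\<bar> * unit_clamp (w n r) + p' * \<bar>unit_clamp (w n r) - unit_clamp (w' r)\<bar>"
          using abs_triangle_ineq p'0 unit_clamp_range(1)[of "w n r"]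
          by (metis abs_mult abs_of_nonneg)
        also have "\<dots> \<le> e' * 1 + p' * e'"
          using elim r p'0 unit_clamp_range[of "w n r"] unit_clamp_lipschitz[of "w n r" "w' r"] e'
          by (intro add_mono mult_mono mult_left_mono) (fastforce simp: dist_real_def)+
        also have "\<dots> \<le> e' * (p' + 2)" using e' by (simp add: algebra_simps)
        also have "\<dots> = e / 2" using p'0 by (simp add: e'_def field_simps)
        finally show ?thesis .
      qed
      then have "mdist Xplus (snd (emb (p n) (l n) (w n))) (snd (emb p' l' w')) \<le> e / 2"
        by (subst mdist_Xplus_le_iff[OF mem]) (simp add: emb_def)
      then show ?case using that by linarith
    qed
  qed
  then have "limitin (mtopology_of Xplus) (\<lambda>n. snd (emb (p n) (l n) (w n))) (snd (emb p' l' w')) sequentially"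
    using mem unfolding mtopology_of_def
    by (subst Metric_space.limitin_metric[OF Metric_space_mspace_mdist]) (auto)
  moreover have "limitin euclidean (\<lambda>n. fst (emb (p n) (l n) (w n))) (fst (emb p' l' w')) sequentially"
    using l by (simp add: emb_def)
  ultimately show ?thesis
    unfolding RXplus_def by (simp add: limitin_pairwise o_def)
qed

text \<open>
  Brouwer's theorem in the \<open>(p, l)\<close> plane: the first component prescribes the amplitude, and the
  second one enforces \<open>w 1 = 0\<close>.
\<close>

lemma delayed_solution_exists:
  assumes \<phi>: "continuous_map (mtopology_of RXplus) (top_of_set {0..1}) \<phi>" and "0 \<le> P" "0 < n"
  defines "W \<equiv> \<lambda>p l. iter (1 / real n) p l n"
  obtains p l where "p \<in> {0..P}" "l \<in> {0..1 / c0 + 1}" "W p l 1 = 0" "p = P * \<phi> (emb p l (W p l))"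
proof -
  \<comment> \<open>\<open>L\<close> exceeds the a priori bound \<open>1 / c0\<close>, so
    \<open>l = L\<close> is incompatible with \<open>0 \<le> W p l 1\<close>.\<close>
  define L where "L = 1 / c0 + 1"
  have L: "0 < L" using c0_pos by (simp add: L_def add_pos_pos)
  \<comment> \<open>The second component is projected back to \<open>[0, L]\<close>, so at a fixed
    point either \<open>W p l 1 = 0\<close> or \<open>l\<close> sits at an end of the interval. The
    two ends are excluded below.\<close>
  define f where "f = (\<lambda>z. (P * \<phi> (emb (fst z) (snd z) (W (fst z) (snd z))),
    max 0 (min L (snd z + W (fst z) (snd z) 1))))"
  have Wc: "continuous_on {0..1} (W p l)" if "0 \<le> p" for p l
    unfolding W_def using that by (intro iter_cont) auto
  have range: "\<phi> x \<in> {0..1}" if "x \<in> mspace RXplus" for x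
    using \<phi> that by (auto simp: continuous_map_in_subtopology)
  have "continuous_on ({0..P} \<times> {0..L}) f"
    unfolding continuous_on_sequentially
  proof (intro allI ballI impI)
    fix x z assume z: "z \<in> {0..P} \<times> {0..L}"
      and x: "(\<forall>k::nat. x k \<in> {0..P} \<times> {0..L}) \<and> x \<longlonglongrightarrow> z"
    have p: "\<And>k. 0 \<le> fst (x k)" "(\<lambda>k. fst (x k)) \<longlonglongrightarrow> fst z" and l: "(\<lambda>k. snd (x k)) \<longlonglongrightarrow> snd z"
      using x by (auto intro!: tendsto_fst tendsto_snd simp: mem_Times_iff)
    have W: "uniform_limit {0..1} (\<lambda>k. W (fst (x k)) (snd (x k))) (W (fst z) (snd z)) sequentially"
      unfolding W_def by (intro iter_uniform_limit p l) simp
    have "limitin (mtopology_of RXplus) (\<lambda>k. emb (fst (x k)) (snd (x k)) (W (fst (x k)) (snd (x k))))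
        (emb (fst z) (snd z) (W (fst z) (snd z))) sequentially"
      by (intro emb_limit p l W Wc)
    then have "limitin euclidean (\<phi> \<circ> (\<lambda>k. emb (fst (x k)) (snd (x k)) (W (fst (x k)) (snd (x k)))))
        (\<phi> (emb (fst z) (snd z) (W (fst z) (snd z)))) sequentially"
      using \<phi> by (intro continuous_map_limit) (auto simp: continuous_map_in_subtopology)
    then have 1: "(\<lambda>k. \<phi> (emb (fst (x k)) (snd (x k)) (W (fst (x k)) (snd (x k)))))
        \<longlonglongrightarrow> \<phi> (emb (fst z) (snd z) (W (fst z) (snd z)))"
      by (simp add: o_def)
    have 2: "(\<lambda>k. W (fst (x k)) (snd (x k)) 1) \<longlonglongrightarrow> W (fst z) (snd z) 1"
      by (rule tendsto_uniform_limitI[OF W]) simp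
    show "(f \<circ> x) \<longlonglongrightarrow> f z"
      unfolding f_def o_def by (intro tendsto_intros 1 2 l)
  qed
  moreover have "f \<in> {0..P} \<times> {0..L} \<rightarrow> {0..P} \<times> {0..L}"
  proof
    fix z assume z: "z \<in> {0..P} \<times> {0..L}"
    then have "\<phi> (emb (fst z) (snd z) (W (fst z) (snd z))) \<in> {0..1}"
      by (intro range emb_mem Wc) (auto simp: mem_Times_iff)
    then show "f z \<in> {0..P} \<times> {0..L}"
      using \<open>0 \<le> P\<close> L by (auto simp: f_def mult_left_le)
  qed
  ultimately obtain z where z: "z \<in> {0..P} \<times> {0..L}" "f z = z"
    using brouwer[of "{0..P} \<times> {0..L}" f] \<open>0 \<le> P\<close> L
    by (auto simp: compact_Times convex_Times)
  obtain p l where pl: "z = (p, l)" by force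
  have p: "p \<in> {0..P}" and l: "l \<in> {0..L}" using z pl by auto
  have 1: "p = P * \<phi> (emb p l (W p l))" and 2: "l = max 0 (min L (l + W p l 1))"
    using z(2) pl by (simp_all add: f_def)
  have fixed: "W p l r = step (1 / real n) p l (W p l) r" if "r \<in> {0..1}" for r
    using iter_fixed[OF \<open>0 < n\<close> that] by (simp add: W_def)
  have "\<not> W p l 1 > 0"
  proof
    assume pos: "W p l 1 > 0"
    then have "l = L" using 2 l by (auto simp: max_def min_def split: if_splits)
    moreover have "l * c0 \<le> 1"
      by (rule step_fixed_bound[OF _ _ _ Wc fixed]) (use p l pos in auto)
    ultimately show False using c0_pos by (simp add: L_def field_simps)
  qed
  \<comment> \<open>A negative end value would push \<open>l\<close> down to 0, but with
    \<open>l = 0\<close> the profile is constantly 1.\<close>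
  moreover have "\<not> W p l 1 < 0"
  proof
    assume neg: "W p l 1 < 0"
    then have "l = 0" using 2 l by (auto simp: max_def min_def split: if_splits)
    then show False using neg fixed[of 1] by (simp add: step_def)
  qed
  ultimately have "W p l 1 = 0" by simp
  then show thesis using that p l 1 unfolding L_def by blast
qed

text \<open>The delays \<open>1 / Suc n\<close> tend to 0, compactness yields a limit, and the
  amplitude constraint passes to it by continuity of \<open>\<phi>\<close>. Suitable choices of
  \<open>\<phi>\<close> later turn the constraint into information on where solutions lie.\<close>

lemma scaled_solution_exists:
  assumes \<phi>: "continuous_map (mtopology_of RXplus) (top_of_set {0..1}) \<phi>" and "0 \<le> P"
  obtains p l w where "scaled_solution p l w" "p = P * \<phi> (emb p l w)"
proof -
  define W where "W = (\<lambda>n p l. iter (1 / real (Suc n)) p l (Suc n))"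
  have "\<exists>p l. p \<in> {0..P} \<and> l \<in> {0..1 / c0 + 1} \<and> W n p l 1 = 0 \<and> p = P * \<phi> (emb p l (W n p l))" for n
    using delayed_solution_exists[OF assms, of "Suc n"] unfolding W_def by blast
  then obtain p l where p: "\<And>n. p n \<in> {0..P}" and l: "\<And>n. l n \<in> {0..1 / c0 + 1}"
    and W1: "\<And>n. W n (p n) (l n) 1 = 0" and eq: "\<And>n. p n = P * \<phi> (emb (p n) (l n) (W n (p n) (l n)))"
    by metis
  have Wc: "continuous_on {0..1} (W n (p n) (l n))" for n
    unfolding W_def using p[of n] by (intro iter_cont) auto
  have d: "(\<lambda>n. 1 / real (Suc n)) \<longlonglongrightarrow> 0"
    by (rule LIMSEQ_Suc) (rule lim_1_over_n)
  obtain k p' l' w' where k: "strict_mono k" "(\<lambda>n. p (k n)) \<longlonglongrightarrow> p'" "(\<lambda>n. l (k n)) \<longlonglongrightarrow> l'"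
    "uniform_limit {0..1} (\<lambda>n. W (k n) (p (k n)) (l (k n))) w' sequentially" "continuous_on {0..1} w'"
    "p' \<in> {0..P}" "l' \<in> {0..1 / c0 + 1}" "\<And>r. r \<in> {0..1} \<Longrightarrow> w' r = step 0 p' l' w' r"
  proof (rule step_fixed_compact[of "\<lambda>n. 1 / real (Suc n)" p P l "1 / c0 + 1" "\<lambda>n. W n (p n) (l n)"])
    show "W n (p n) (l n) r = step (1 / real (Suc n)) (p n) (l n) (W n (p n) (l n)) r"
      if "r \<in> {0..1}" for n r
      unfolding W_def by (rule iter_fixed[OF _ that]) simp
  qed (use d p l Wc in \<open>simp_all\<close>)
  have "(\<lambda>n. W (k n) (p (k n)) (l (k n)) 1) \<longlonglongrightarrow> w' 1"
    by (rule tendsto_uniform_limitI[OF k(4)]) simp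
  then have "w' 1 = 0" using W1 by (simp add: LIMSEQ_const_iff)
  then have sol: "scaled_solution p' l' w'"
    using k by (auto simp: scaled_solution_def)
  have "limitin (mtopology_of RXplus) (\<lambda>n. emb (p (k n)) (l (k n)) (W (k n) (p (k n)) (l (k n))))
      (emb p' l' w') sequentially"
    using p by (intro emb_limit k Wc) auto
  then have "limitin euclidean (\<phi> \<circ> (\<lambda>n. emb (p (k n)) (l (k n)) (W (k n) (p (k n)) (l (k n)))))
      (\<phi> (emb p' l' w')) sequentially"
    using \<phi> by (intro continuous_map_limit) (auto simp: continuous_map_in_subtopology)
  then have "(\<lambda>n. P * \<phi> (emb (p (k n)) (l (k n)) (W (k n) (p (k n)) (l (k n))))) \<longlonglongrightarrow> P * \<phi> (emb p' l' w')"
    by (intro tendsto_mult tendsto_const) (simp add: o_def)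
  then have "(\<lambda>n. p (k n)) \<longlonglongrightarrow> P * \<phi> (emb p' l' w')"
    using eq by simp
  then have "p' = P * \<phi> (emb p' l' w')"
    using k(2) LIMSEQ_unique by blast
  then show thesis using that sol by blast
qed

subsection \<open>The first eigenvalue\<close>

lemma scaled_solution_range:
  assumes "scaled_solution p l w" "r \<in> {0..1}"
  shows "1 - r \<le> w r" "w r \<le> 1" "unit_clamp (w r) = w r"
proof -
  have s: "0 \<le> p" "0 \<le> l" "continuous_on {0..1} w" "\<And>r. r \<in> {0..1} \<Longrightarrow> w r = step 0 p l w r" "w 1 = 0"
    using assms(1) by (auto simp: scaled_solution_def)
  show 1: "1 - r \<le> w r"
    by (rule step_fixed_lower[OF _ s(1-4)]) (use s(5) assms(2) in auto)
  have "0 \<le> J p w r"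
    unfolding J_def using assms(2) by (intro continuous_density.nonneg scaled_density_valid s) auto
  then show 2: "w r \<le> 1"
    using s(4)[OF assms(2)] step_0[OF assms(2), of p l w] s(2) by simp
  show "unit_clamp (w r) = w r"
    using 1 2 assms(2) by (intro unit_clamp_id) auto
qed

text \<open>The end condition \<open>w 1 = 0\<close> converts the initial value form into the
  fixed-point form that matches \<open>T_op\<close>.\<close>

lemma scaled_solution_J:
  assumes "scaled_solution p l w"
  shows "l * J p w 1 = 1" "r \<in> {0..1} \<Longrightarrow> w r = l * (J p w 1 - J p w r)"
proof -
  have s: "w r = 1 - l * J p w r" if "r \<in> {0..1}" for r
    using assms that step_0 unfolding scaled_solution_def by metis
  show 1: "l * J p w 1 = 1" using s[of 1] assms by (simp add: scaled_solution_def)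
  show "w r = l * (J p w 1 - J p w r)" if "r \<in> {0..1}"
    using s[OF that] 1 by (simp add: algebra_simps)
qed

lemma scaled_solution_pos: "scaled_solution p l w \<Longrightarrow> 0 < l"
  using scaled_solution_J(1)[of p l w] by (cases "l = 0") (auto simp: scaled_solution_def)

lemma scaled_solution_bound:
  assumes "scaled_solution p l w"
  shows "l \<le> 1 / c0"
proof -
  have "l * c0 \<le> 1"
    by (rule step_fixed_bound[of 0 p l w]) (use assms in \<open>auto simp: scaled_solution_def\<close>)
  then show ?thesis using c0_pos by (simp add: field_simps)
qed

text \<open>Unlike in \<open>J 0\<close> there is no clamp, so moduli of eigenfunctions of any size
  and multiples of \<open>w\<close> may be inserted.\<close>

definition homog :: "(real \<Rightarrow> real) \<Rightarrow> real \<Rightarrow> real" where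
  "homog u = iterated_root_integral N (\<lambda>t. weight t * u t ^ N)"

lemma homog_valid:
  assumes "continuous_on {0..1} u" "\<And>t. t \<in> {0..1} \<Longrightarrow> 0 \<le> u t"
  shows "continuous_density N (\<lambda>t. weight t * u t ^ N)"
proof
  show "0 < N" using N by simp
  show "continuous_on {0..1} (\<lambda>t. weight t * u t ^ N)"
    by (intro continuous_intros weight_cont assms(1))
  show "0 \<le> weight t * u t ^ N" if "t \<in> {0..1}" for t
    by (intro mult_nonneg_nonneg zero_le_power weight_nonneg assms(2) that)
qed

lemma J_0_homog:
  assumes "scaled_solution p l w" "r \<le> 1"
  shows "J 0 w r = homog w r"
  unfolding J_def homog_def
  by (rule iterated_root_integral_cong)
    (use assms in \<open>simp add: scaled_density_def quot_0 scaled_solution_range(3)[OF assms(1)]\<close>)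

text \<open>Iterating the subsolution inequality gives \<open>u \<le> C (l' / l)\<^sup>n w\<close>, which forces \<open>u = 0\<close> if \<open>l' < l\<close>.\<close>

lemma le_eigenvalue_of_subsolution:
  assumes sol: "scaled_solution 0 l w" and u: "continuous_on {0..1} u" "\<And>t. t \<in> {0..1} \<Longrightarrow> 0 \<le> u t"
    and nz: "t0 \<in> {0..1}" "u t0 \<noteq> 0" and l': "0 \<le> l'"
    and sub: "\<And>r. r \<in> {0..1} \<Longrightarrow> u r \<le> l' * (homog u 1 - homog u r)"
  shows "l \<le> l'"
proof (rule ccontr)
  assume "\<not> l \<le> l'"
  then have less: "l' < l" by simp
  have l: "0 < l" by (rule scaled_solution_pos[OF sol])
  have wc: "continuous_on {0..1} w"
    using sol by (auto simp: scaled_solution_def)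
  have w0: "0 \<le> w t" if "t \<in> {0..1}" for t
    using scaled_solution_range(1)[OF sol that] that by auto
  interpret U: continuous_density N "\<lambda>t. weight t * u t ^ N" by (rule homog_valid[OF u])
  obtain M where "\<forall>x\<in>(\<lambda>t. weight t * u t ^ N) ` {0..1}. \<bar>x\<bar> \<le> M"
    using compact_imp_bounded[OF compact_continuous_image[OF U.f_cont compact_Icc]]
    unfolding bounded_real by blast
  then have M: "weight t * u t ^ N \<le> M" if "t \<in> {0..1}" for t
    using that by (meson abs_le_D1 imageI)
  \<comment> \<open>This constant starts the induction: the Lipschitz bound for
    \<open>homog u\<close> gives \<open>u r \<le> C * (1 - r)\<close>, and
    \<open>1 - r \<le> w r\<close>. Linear decay at 1 is essential because \<open>w\<close> vanishes
    there.\<close>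
  define C where "C = l' * root N M"
  have M0: "0 \<le> M" using M[of 0] U.f_nonneg[of 0] by simp
  have C0: "0 \<le> C" unfolding C_def using l' M0 N by simp
  have *: "u r \<le> C * (l' / l) ^ n * w r" if "r \<in> {0..1}" for r n
    using that
  proof (induction n arbitrary: r)
    case 0
    have "u r \<le> l' * (homog u 1 - homog u r)" by (rule sub[OF 0])
    also have "\<dots> \<le> l' * (root N M * (1 - r))"
      using U.lipschitz[OF M, of 1 r] 0 l' unfolding homog_def by (intro mult_left_mono) auto
    also have "\<dots> = C * (1 - r)" by (simp add: C_def)
    also have "\<dots> \<le> C * w r"
      using scaled_solution_range(1)[OF sol 0] C0 by (rule mult_left_mono)
    finally show ?case by simp
  next
    case (Suc n)
    let ?c = "C * (l' / l) ^ n"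
    have c0: "0 \<le> ?c" using C0 l l' by simp
    have "homog u 1 - homog u r \<le> homog (\<lambda>t. ?c * w t) 1 - homog (\<lambda>t. ?c * w t) r"
      unfolding homog_def
    proof (rule iterated_root_integral_mono)
      show "continuous_density N (\<lambda>t. weight t * (?c * w t) ^ N)"
      proof (rule homog_valid)
        show "continuous_on {0..1} (\<lambda>t. ?c * w t)" by (intro continuous_intros wc)
        show "0 \<le> ?c * w t" if "t \<in> {0..1}" for t
          using c0 w0[OF that] by (rule mult_nonneg_nonneg)
      qed
      show "weight t * u t ^ N \<le> weight t * (?c * w t) ^ N" if "t \<in> {0..1}" for t
        by (intro mult_left_mono power_mono Suc.IH weight_nonneg u that)
    qed (use Suc.prems in \<open>auto intro: U.continuous_density_axioms\<close>)
    \<comment> \<open>Homogeneity of degree one: each pass through the inequality multiplies the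
      constant by \<open>l' / l\<close>.\<close>
    also have "homog (\<lambda>t. ?c * w t) = (\<lambda>r. ?c * homog w r)"
      unfolding homog_def using iterated_root_integral_scale[OF _ c0, of N "\<lambda>t. weight t * w t ^ N"] N
      by (simp add: power_mult_distrib mult.left_commute fun_eq_iff)
    finally have "l' * (homog u 1 - homog u r) \<le> l' * (?c * (homog w 1 - homog w r))"
      using l' by (intro mult_left_mono) (simp_all add: right_diff_distrib)
    also have "homog w 1 - homog w r = w r / l"
      using scaled_solution_J(2)[OF sol Suc.prems] J_0_homog[OF sol] Suc.prems l by (simp add: field_simps)
    finally show ?case
      using sub[OF Suc.prems] by (simp add: algebra_simps)
  qed
  have "(\<lambda>n. C * (l' / l) ^ n * w t0) \<longlonglongrightarrow> C * 0 * w t0"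
    using l l' less by (intro tendsto_intros LIMSEQ_realpow_zero) auto
  then have "u t0 \<le> 0"
    using *[OF nz(1)] by (intro LIMSEQ_le_const[of _ 0 "u t0"]) auto
  then show False using u(2)[OF nz(1)] nz(2) by simp
qed

text \<open>Integrate the equation twice, using \<open>v' 0 = 0\<close> and then
  \<open>v 1 = 0\<close>, and take absolute values under both integrals. Since
  \<open>\<bar>v ^ N\<bar> = \<bar>v\<bar> ^ N\<close>, the sign of \<open>v\<close> is
  irrelevant.\<close>

lemma eigenfunction_abs_subsolution:
  assumes v: "solves_eigenproblem N a l v" and l: "0 < l" and r: "r \<in> {0..1}"
  shows "\<bar>v r\<bar> \<le> l * (homog (\<lambda>t. \<bar>v t\<bar>) 1 - homog (\<lambda>t. \<bar>v t\<bar>) r)"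
proof -
  obtain v' where v'c: "continuous_on {0..1} v'"
    and d: "\<And>r. r \<in> {0..1} \<Longrightarrow> (v has_real_derivative v' r) (at r within {0..1})"
    and dd: "\<And>r. r \<in> {0<..<1} \<Longrightarrow> ((\<lambda>s. (- v' s) ^ N) has_real_derivative
                            l ^ N * real N * r ^ (N - 1) * a r * v r ^ N) (at r)"
    and bc: "v' 0 = 0" "v 1 = 0"
    using v unfolding solves_eigenproblem_def by blast
  have vc: "continuous_on {0..1} v" by (rule DERIV_continuous_on[OF d])
  interpret V: continuous_density N "\<lambda>t. weight t * \<bar>v t\<bar> ^ N"
    by (rule homog_valid) (simp_all add: continuous_on_rabs[OF vc])
  have v'le: "\<bar>v' s\<bar> \<le> l * root N (integral {0..s} (\<lambda>t. weight t * \<bar>v t\<bar> ^ N))" if s: "s \<in> {0..1}" for s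
  proof -
    have "((\<lambda>t. l ^ N * (weight t * v t ^ N)) has_integral (- v' s) ^ N - (- v' 0) ^ N) {0..s}"
    proof (rule fundamental_theorem_of_calculus_interior)
      show "continuous_on {0..s} (\<lambda>t. (- v' t) ^ N)"
        using s by (intro continuous_intros continuous_on_subset[OF v'c]) auto
      show "((\<lambda>s. (- v' s) ^ N) has_vector_derivative l ^ N * (weight t * v t ^ N)) (at t)"
        if "t \<in> {0<..<s}" for t
        using dd[of t] that s
        by (simp add: has_real_derivative_iff_has_vector_derivative weight_def mult.assoc)
    qed (use s in auto)
    then have I: "((\<lambda>t. l ^ N * (weight t * v t ^ N)) has_integral (- v' s) ^ N) {0..s}"
      using bc(1) N by (simp add: zero_power)
    have "norm ((- v' s) ^ N) \<le> integral {0..s} (\<lambda>t. l ^ N * (weight t * \<bar>v t\<bar> ^ N))"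
      unfolding integral_unique[OF I, symmetric]
    proof (rule integral_norm_bound_integral)
      show "(\<lambda>t. l ^ N * (weight t * v t ^ N)) integrable_on {0..s}" using I by blast
      show "(\<lambda>t. l ^ N * (weight t * \<bar>v t\<bar> ^ N)) integrable_on {0..s}"
        using s by (intro integrable_on_mult_right V.f_integrable) auto
      show "norm (l ^ N * (weight t * v t ^ N)) \<le> l ^ N * (weight t * \<bar>v t\<bar> ^ N)" if "t \<in> {0..s}" for t
        using l s that weight_nonneg[of t] by (simp add: abs_mult power_abs)
    qed
    then have "\<bar>v' s\<bar> ^ N \<le> l ^ N * integral {0..s} (\<lambda>t. weight t * \<bar>v t\<bar> ^ N)"
      by (simp add: power_abs)
    then have "root N (\<bar>v' s\<bar> ^ N) \<le> root N (l ^ N * integral {0..s} (\<lambda>t. weight t * \<bar>v t\<bar> ^ N))"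
      using N by simp
    then show ?thesis
      using N l by (simp add: real_root_mult real_root_power_cancel)
  qed
  have "(v' has_integral v 1 - v r) {r..1}"
    using r by (intro fundamental_theorem_of_calculus)
      (auto intro: DERIV_subset[OF d] simp: has_real_derivative_iff_has_vector_derivative[symmetric])
  then have I: "(v' has_integral - v r) {r..1}" using bc by simp
  have "norm (- v r) \<le> integral {r..1} (\<lambda>s. l * root N (integral {0..s} (\<lambda>t. weight t * \<bar>v t\<bar> ^ N)))"
    unfolding integral_unique[OF I, symmetric]
    by (rule integral_norm_bound_integral)
      (use I r v'le in \<open>auto intro!: integrable_on_mult_right V.root_inner_integrable\<close>)
  then show ?thesis
    using V.diff_eq_integral[of r 1] r by (simp add: homog_def)
qed

lemma scaled_solution_eigenvalue:
  assumes sol: "scaled_solution 0 l w"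
  shows "eigenvalue N a l"
proof -
  have wc: "continuous_on {0..1} w"
    using sol by (auto simp: scaled_solution_def)
  have w0: "0 \<le> w t" if "t \<in> {0..1}" for t
    using scaled_solution_range(1)[OF sol that] that by auto
  have l: "0 < l" by (rule scaled_solution_pos[OF sol])
  interpret W: continuous_density N "\<lambda>t. weight t * w t ^ N" by (rule homog_valid[OF wc w0])
  define v' where "v' = (\<lambda>r. - l * root N (integral {0..r} (\<lambda>t. weight t * w t ^ N)))"
  have weq: "w r = l * (homog w 1 - homog w r)" if "r \<in> {0..1}" for r
    using scaled_solution_J(2)[OF sol that] J_0_homog[OF sol] that by simp
  have "solves_eigenproblem N a l w"
    unfolding solves_eigenproblem_def
  proof (intro exI[of _ v'] conjI ballI)
    show "continuous_on {0..1} v'"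
      unfolding v'_def by (intro continuous_intros W.root_inner_cont)
    show "(w has_real_derivative v' r) (at r within {0..1})" if r: "r \<in> {0..1}" for r
    proof -
      have "((\<lambda>r. l * (homog w 1 - homog w r)) has_real_derivative v' r) (at r within {0..1})"
        unfolding v'_def homog_def by (auto intro!: derivative_eq_intros W.deriv[OF r])
      then show ?thesis
        by (rule has_field_derivative_transform_within[OF _ zero_less_one r]) (use weq in auto)
    qed
    show "((\<lambda>s. (- v' s) ^ N) has_real_derivative l ^ N * real N * r ^ (N - 1) * a r * w r ^ N) (at r)"
      if r: "r \<in> {0<..<1}" for r
    proof -
      have D: "((\<lambda>s. l ^ N * integral {0..s} (\<lambda>t. weight t * w t ^ N)) has_real_derivative
          l ^ N * real N * r ^ (N - 1) * a r * w r ^ N) (at r)"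
        using W.inner_deriv[OF r] by (auto intro!: derivative_eq_intros simp: weight_def)
      \<comment> \<open>The root disappears in the \<open>N\<close>-th power, as the inner integral
        is nonnegative, so only the integral has to be differentiated.\<close>
      have *: "l ^ N * integral {0..s} (\<lambda>t. weight t * w t ^ N) = (- v' s) ^ N" if "s \<in> {0<..<1}" for s
        using W.inner_nonneg[of s] that N by (simp add: v'_def power_mult_distrib real_root_pow_pos2)
      show ?thesis
        by (rule has_field_derivative_transform_within_open[OF D open_greaterThanLessThan r *])
    qed
    show "v' 0 = 0" by (simp add: v'_def)
    show "w 1 = 0" using sol by (simp add: scaled_solution_def)
  qed
  moreover have "w 0 \<noteq> 0" using scaled_solution_range(1)[OF sol, of 0] by simp
  ultimately show ?thesis
    using l unfolding eigenvalue_def by (auto intro!: exI[of _ w] bexI[of _ 0])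
qed

text \<open>Every eigenvalue \<open>l'\<close> yields the subsolution \<open>\<bar>v\<bar>\<close>,
  hence \<open>l \<le> l'\<close>, so the least eigenvalue is attained at \<open>l\<close>. In
  particular amplitude 0 admits a single value of \<open>l\<close>.\<close>

lemma lambda1_eq:
  assumes sol: "scaled_solution 0 l w"
  shows "lambda1 N a = l"
  unfolding lambda1_def
proof (rule Least_equality)
  show "eigenvalue N a l" by (rule scaled_solution_eigenvalue[OF sol])
  fix l' assume "eigenvalue N a l'"
  then obtain v t0 where v: "0 < l'" "solves_eigenproblem N a l' v" "t0 \<in> {0..1}" "v t0 \<noteq> 0"
    unfolding eigenvalue_def by blast
  then have vc: "continuous_on {0..1} v"
    unfolding solves_eigenproblem_def by (meson DERIV_continuous_on)
  show "l \<le> l'"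
  proof (rule le_eigenvalue_of_subsolution[OF sol])
    show "continuous_on {0..1} (\<lambda>t. \<bar>v t\<bar>)" by (intro continuous_intros vc)
    show "\<bar>v r\<bar> \<le> l' * (homog (\<lambda>t. \<bar>v t\<bar>) 1 - homog (\<lambda>t. \<bar>v t\<bar>) r)" if "r \<in> {0..1}" for r
      by (rule eigenfunction_abs_subsolution[OF v(2,1) that])
  qed (use v in auto)
qed

lemma zero_amplitude_emb: "scaled_solution 0 l w \<Longrightarrow> emb 0 l w = (lambda1 N a, zeroX)"
  using lambda1_eq by (auto simp: emb_def zeroX_def)

text \<open>Undoing the normalisation: the factor \<open>p ^ N\<close> of the density leaves the
  root as \<open>p\<close>, and the clamp is inactive on solutions.\<close>

lemma scaled_solution_nontrivial:
  assumes sol: "scaled_solution p l w" and p: "0 < p"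
  shows "emb p l w \<in> nontrivial_solutions N a g" "snd (emb p l w) 0 = p"
proof -
  let ?v = "\<lambda>r\<in>{0..1}. p * unit_clamp (w r)"
  have wc: "continuous_on {0..1} w" using sol by (auto simp: scaled_solution_def)
  interpret W: continuous_density N "scaled_density p w" by (rule scaled_density_valid) (use p wc in auto)
  have w0: "w 0 = 1" using scaled_solution_range[OF sol, of 0] by simp
  have dens: "real N * t ^ (N - 1) * a t * (?v t ^ N + g (?v t)) = p ^ N * scaled_density p w t" if "t \<in> {0..1}" for t
  proof -
    have "?v t ^ N + g (?v t) = (p * unit_clamp (w t)) ^ N * (1 + quot (p * unit_clamp (w t)))"
      using that power_add_g[of "p * unit_clamp (w t)"] p unit_clamp_range(1)[of "w t"] by simp
    then show ?thesis
      by (simp add: scaled_density_def weight_def power_mult_distrib mult_ac)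
  qed
  have T: "T_op N a g ?v r = p * (J p w 1 - J p w r)" if r: "r \<in> {0..1}" for r
  proof -
    have "root N (integral {0..s} (\<lambda>t. real N * t ^ (N - 1) * a t * (?v t ^ N + g (?v t))))
      = p * root N (integral {0..s} (scaled_density p w))" if "s \<in> {r..1}" for s
    proof -
      have "integral {0..s} (\<lambda>t. real N * t ^ (N - 1) * a t * (?v t ^ N + g (?v t)))
        = integral {0..s} (\<lambda>t. p ^ N * scaled_density p w t)"
        by (rule integral_cong) (rule dens, use that r in auto)
      then show ?thesis
        using N p by (simp add: real_root_mult real_root_power_cancel)
    qed
    then have "T_op N a g ?v r = integral {r..1} (\<lambda>s. p * root N (integral {0..s} (scaled_density p w)))"
      unfolding T_op_def by (rule integral_cong)
    then show ?thesis
      using W.diff_eq_integral[of r 1] r by (simp add: J_def)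
  qed
  have "?v r = l * T_op N a g ?v r" if "r \<in> {0..1}" for r
    using scaled_solution_J(2)[OF sol that] scaled_solution_range(3)[OF sol that] that
    unfolding T[OF that] by simp
  moreover have "?v \<in> mspace Xplus"
    using emb_mem[of p w l] p wc by (simp add: emb_def mspace_RXplus)
  moreover have "?v 0 \<noteq> 0" using p w0 by (simp add: unit_clamp_def)
  ultimately have "(l, ?v) \<in> nontrivial_solutions N a g"
    unfolding nontrivial_solutions_def solutions_def mem_Collect_eq prod.case
    by (intro conjI ballI bexI[of _ 0]) auto
  then show "emb p l w \<in> nontrivial_solutions N a g" by (simp add: emb_def)
  show "snd (emb p l w) 0 = p" using w0 by (simp add: emb_def unit_clamp_def)
qed

subsection \<open>The branch\<close>

lemma metrizable_RXplus: "metrizable_space (mtopology_of RXplus)"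
  unfolding mtopology_of_def by (rule Metric_space.metrizable_space_mtopology) simp

lemma nontrivial_solutions_subset: "nontrivial_solutions N a g \<subseteq> mspace RXplus"
  by (auto simp: nontrivial_solutions_def solutions_def mspace_RXplus)

text \<open>If \<open>U\<close> contained no nontrivial solution, take a Urysohn function
  \<open>f\<close> equal to 1 at the point and 0 off \<open>U\<close>, and a solution of amplitude
  \<open>p = f (emb p l w)\<close>. Amplitude 0 would place it at the point, where
  \<open>f = 1\<close>; positive amplitude places it outside \<open>U\<close>, where
  \<open>f = 0\<close>.\<close>

lemma lambda1_bifurcation_point: "bifurcation_point N a g (lambda1 N a)"
  unfolding bifurcation_point_def
proof (intro allI impI notI, elim conjE)
  let ?T = "mtopology_of RXplus" and ?x = "(lambda1 N a, zeroX)"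
  fix U assume U: "openin ?T U" "?x \<in> U" and disj: "U \<inter> nontrivial_solutions N a g = {}"
  have x: "?x \<in> topspace ?T" using zeroX_mem by (simp add: mspace_RXplus)
  have "normal_space ?T" "Hausdorff_space ?T"
    by (simp_all only: metrizable_imp_normal_space metrizable_imp_Hausdorff_space metrizable_RXplus)
  moreover have "closedin ?T (topspace ?T - U)" using U by blast
  moreover have "closedin ?T {?x}"
    using x \<open>Hausdorff_space ?T\<close> by (simp add: closedin_Hausdorff_singleton)
  ultimately obtain f where f: "continuous_map ?T (top_of_set {0..1}) f"
    "f ` (topspace ?T - U) \<subseteq> {0::real}" "f ` {?x} \<subseteq> {1}"
    using Urysohn_lemma[of ?T "topspace ?T - U" "{?x}" 0 1] U by (auto simp: disjnt_iff)
  obtain p l w where sol: "scaled_solution p l w" and p: "p = f (emb p l w)"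
    using scaled_solution_exists[OF f(1), of 1] by auto
  have "p \<noteq> 0"
  proof
    assume "p = 0"
    then show False using p sol f(3) by (simp add: zero_amplitude_emb)
  qed
  then have "0 < p" using sol by (simp add: scaled_solution_def)
  then have "emb p l w \<in> topspace ?T - U"
    using scaled_solution_nontrivial(1)[OF sol] nontrivial_solutions_subset disj by auto
  then show False using f(2) p \<open>0 < p\<close> by auto
qed

section \<open>Compactness of the solutions of bounded amplitude\<close>

definition bounded_solutions :: "real \<Rightarrow> (real \<times> (real \<Rightarrow> real)) set" where
  "bounded_solutions P = {emb p l w |p l w. scaled_solution p l w \<and> p \<le> P}"

text \<open>Amplitudes lie in \<open>[0, P]\<close> and parameters in \<open>[0, 1 / c0]\<close>, so
  \<open>step_fixed_compact\<close> applies without delay. Admitting amplitude 0 keeps the limits in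
  the set.\<close>

lemma compactin_bounded_solutions: "compactin (mtopology_of RXplus) (bounded_solutions P)"
  unfolding mtopology_of_def Metric_space.compactin_sequentially[OF Metric_space_mspace_mdist]
proof (intro conjI allI impI)
  show "bounded_solutions P \<subseteq> mspace RXplus"
    by (auto simp: bounded_solutions_def scaled_solution_def intro!: emb_mem)
  fix \<sigma> :: "nat \<Rightarrow> real \<times> (real \<Rightarrow> real)" assume "range \<sigma> \<subseteq> bounded_solutions P"
  then have "\<forall>n. \<exists>p l w. \<sigma> n = emb p l w \<and> scaled_solution p l w \<and> p \<le> P"
    unfolding bounded_solutions_def by blast
  then obtain p l w where \<sigma>: "\<And>n. \<sigma> n = emb (p n) (l n) (w n)"
    and sol: "\<And>n. scaled_solution (p n) (l n) (w n)" and P: "\<And>n. p n \<le> P"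
    by metis
  have s: "0 \<le> p n" "0 \<le> l n" "continuous_on {0..1} (w n)" "w n 1 = 0"
    and eq: "\<And>r. r \<in> {0..1} \<Longrightarrow> w n r = step 0 (p n) (l n) (w n) r" for n
    using sol[of n] by (auto simp: scaled_solution_def)
  obtain k p' l' w' where k: "strict_mono k" "(\<lambda>n. p (k n)) \<longlonglongrightarrow> p'" "(\<lambda>n. l (k n)) \<longlonglongrightarrow> l'"
    "uniform_limit {0..1} (\<lambda>n. w (k n)) w' sequentially" "continuous_on {0..1} w'"
    "p' \<in> {0..P}" "l' \<in> {0..1 / c0}" "\<And>r. r \<in> {0..1} \<Longrightarrow> w' r = step 0 p' l' w' r"
  proof (rule step_fixed_compact[of "\<lambda>_. 0" p P l "1 / c0" w])
    show "p n \<in> {0..P}" "l n \<in> {0..1 / c0}" for n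
      using s(1,2)[of n] P[of n] scaled_solution_bound[OF sol[of n]] by auto
    show "w n r = step 0 (p n) (l n) (w n) r" if "r \<in> {0..1}" for n r
      by (rule eq[OF that])
  qed (use s(3) in auto)
  have "(\<lambda>n. w (k n) 1) \<longlonglongrightarrow> w' 1"
    by (rule tendsto_uniform_limitI[OF k(4)]) simp
  then have "w' 1 = 0" using s(4) by (simp add: LIMSEQ_const_iff)
  then have "scaled_solution p' l' w'"
    using k by (auto simp: scaled_solution_def)
  then have "emb p' l' w' \<in> bounded_solutions P"
    using k(6) unfolding bounded_solutions_def by auto
  moreover have "limitin (mtopology_of RXplus) (\<sigma> \<circ> k) (emb p' l' w') sequentially"
    unfolding \<sigma> o_def by (intro emb_limit k s)
  ultimately show "\<exists>x r. x \<in> bounded_solutions P \<and> strict_mono r \<and>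
      limitin (Metric_space.mtopology (mspace RXplus) (mdist RXplus)) (\<sigma> \<circ> r) x sequentially"
    using k(1) unfolding mtopology_of_def by blast
qed

lemma lambda1_in_closure:
  "(lambda1 N a, zeroX) \<in> mtopology_of RXplus closure_of nontrivial_solutions N a g"
  using lambda1_bifurcation_point zeroX_mem unfolding bifurcation_point_def
  by (auto simp: in_closure_of mspace_RXplus)

text \<open>Amplitude 0 contributes only the bifurcation point, which is in the closure. Hence
  connected sets of bounded solutions through that point lie in the branch.\<close>

lemma bounded_solutions_subset:
  "bounded_solutions P \<subseteq> mtopology_of RXplus closure_of nontrivial_solutions N a g"
proof
  fix x assume "x \<in> bounded_solutions P"
  then obtain p l w where x: "x = emb p l w" "scaled_solution p l w"
    unfolding bounded_solutions_def by blast
  show "x \<in> mtopology_of RXplus closure_of nontrivial_solutions N a g"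
  proof (cases "p = 0")
    case True
    then show ?thesis using x lambda1_in_closure zero_amplitude_emb by simp
  next
    case False
    then have "x \<in> nontrivial_solutions N a g"
      using x scaled_solution_nontrivial(1) by (auto simp: scaled_solution_def)
    then show ?thesis
      using closure_of_subset[of "nontrivial_solutions N a g" "mtopology_of RXplus"]
        nontrivial_solutions_subset by auto
  qed
qed

text \<open>On solutions the value at 0 is the amplitude, so the sphere of radius \<open>P\<close>
  is detected by a continuous function.\<close>

lemma continuous_map_eval_0: "continuous_map (mtopology_of RXplus) euclideanreal (\<lambda>z. snd z 0)"
proof -
  have "Lipschitz_continuous_map Xplus euclidean_metric (\<lambda>v. v 0)"
    unfolding Lipschitz_continuous_map_def
  proof (intro conjI exI[of _ 1] ballI)
    fix u v assume "u \<in> mspace Xplus" "v \<in> mspace Xplus"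
    then show "mdist euclidean_metric (u 0) (v 0) \<le> 1 * mdist Xplus u v"
      using mdist_Xplus_le_iff[of u v "mdist Xplus u v"] by (simp add: dist_real_def)
  qed auto
  then have "continuous_map (mtopology_of Xplus) euclideanreal (\<lambda>v. v 0)"
    using Lipschitz_continuous_imp_continuous_map by fastforce
  then have "continuous_map (mtopology_of RXplus) euclideanreal ((\<lambda>v. v 0) \<circ> snd)"
    unfolding RXplus_def mtopology_of_prod_metric by (intro continuous_map_compose[OF continuous_map_snd])
  then show ?thesis by (simp add: o_def)
qed

section \<open>Unboundedness of the branch\<close>

lemma branch_meets_sphere:
  assumes P: "0 < P"
  obtains z where "z \<in> branch N a g (lambda1 N a)" "snd z 0 = P"
proof (rule ccontr)
  assume "\<not> thesis"
  then have none: "snd z 0 \<noteq> P" if "z \<in> branch N a g (lambda1 N a)" for z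
    using that(1) \<open>\<And>z. \<lbrakk>z \<in> branch N a g (lambda1 N a); snd z 0 = P\<rbrakk> \<Longrightarrow> thesis\<close> by blast
  let ?T = "mtopology_of RXplus" and ?x = "(lambda1 N a, zeroX)"
  define X where "X = subtopology ?T (bounded_solutions P)"
  define C where "C = connected_component_of_set X ?x"
  define W where "W = {z \<in> topspace X. snd z 0 \<in> - {P}}"
  have T: "normal_space ?T" "Hausdorff_space ?T"
    by (simp_all only: metrizable_imp_normal_space metrizable_imp_Hausdorff_space metrizable_RXplus)
  have top: "topspace X = bounded_solutions P"
    using compactin_subset_topspace[OF compactin_bounded_solutions[of P]] by (auto simp: X_def)
  have comp: "compact_space X" and haus: "Hausdorff_space X"
    using compactin_bounded_solutions[of P] T(2)
    by (auto simp: X_def compactin_subspace Hausdorff_space_subtopology)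
  \<comment> \<open>The constant function 0 forces amplitude 0 and so produces an eigenfunction;
    this places the bifurcation point in \<open>X\<close>.\<close>
  obtain p l w where "scaled_solution p l w" "p = P * 0"
    using scaled_solution_exists[of "\<lambda>_. 0" P] P by auto
  then have sol0: "scaled_solution 0 l w" by simp
  then have "emb 0 l w \<in> bounded_solutions P"
    using less_imp_le[OF P] unfolding bounded_solutions_def mem_Collect_eq by blast
  then have x: "?x \<in> bounded_solutions P"
    unfolding zero_amplitude_emb[OF sol0] .
  have C: "C \<in> connected_components_of X"
    unfolding C_def connected_components_of_def using x top by blast
  have "C \<subseteq> branch N a g (lambda1 N a)"
    unfolding C_def branch_def X_def
    using connected_component_of_mono[OF _ bounded_solutions_subset[of P]] by auto
  moreover have "C \<subseteq> topspace X"
    unfolding C_def by (rule connected_component_of_subset_topspace)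
  ultimately have "C \<subseteq> W" using none unfolding W_def by auto
  moreover have "openin X W"
    unfolding W_def
    by (rule openin_continuous_map_preimage[of _ euclideanreal])
      (auto simp: X_def intro: continuous_map_from_subtopology continuous_map_eval_0)
  moreover have "compactin X C"
    using comp closedin_compact_space closedin_connected_components_of[OF C] by blast
  \<comment> \<open>In a compact Hausdorff space a component contained in an open set
    \<open>W\<close> has a clopen neighbourhood inside \<open>W\<close>.\<close>
  ultimately obtain U V where UV: "openin X U" "openin X V" "disjnt U V" "U \<union> V = topspace X"
    "C \<subseteq> U" "U \<subseteq> W"
    using wilder_locally_compact_component_thm[OF _ haus C] comp compact_imp_locally_compact_space
    by metis
  have "closedin X U" "closedin X V"
  proof -
    have "topspace X - U = V" "topspace X - V = U"
      using UV(3,4) by (auto simp: disjnt_iff)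
    then show "closedin X U" "closedin X V"
      unfolding closedin_def using UV(1,2) openin_subset by metis+
  qed
  \<comment> \<open>The Urysohn function must live on the whole space. Clopen parts of the compact
    \<open>X\<close> are compact, hence closed there.\<close>
  then have "compactin X U" "compactin X V"
    using comp closedin_compact_space by auto
  then have "compactin ?T U" "compactin ?T V"
    by (auto simp: X_def compactin_subtopology)
  then have "closedin ?T U" "closedin ?T V"
    using T(2) compactin_imp_closedin by auto
  then obtain f where f: "continuous_map ?T (top_of_set {0..1}) f" "f ` V \<subseteq> {0::real}" "f ` U \<subseteq> {1}"
    using Urysohn_lemma[OF T(1), of V U 0 1] UV(3) disjnt_sym by auto
  obtain p l w where sol: "scaled_solution p l w" and p: "p = P * f (emb p l w)"
    using scaled_solution_exists[OF f(1), of P] P by auto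
  have "emb p l w \<in> mspace RXplus"
    using sol by (intro emb_mem) (auto simp: scaled_solution_def)
  then have "f (emb p l w) \<le> 1"
    using f(1) by (auto simp: continuous_map_in_subtopology)
  then have "p \<le> P" using p P by (metis mult_left_le order_less_imp_le)
  then have "emb p l w \<in> U \<union> V"
    using sol unfolding UV(4) top bounded_solutions_def by blast
  moreover have "p \<noteq> 0"
  proof
    assume "p = 0"
    moreover have "?x \<in> C"
      unfolding C_def using x top by (simp add: connected_component_of_refl)
    ultimately have "f (emb p l w) = 1" using f(3) UV(5) sol zero_amplitude_emb by auto
    then show False using p P \<open>p = 0\<close> by simp
  qed
  \<comment> \<open>A nonzero amplitude excludes \<open>V\<close>, where \<open>f = 0\<close>. On
    \<open>U\<close> the constraint gives amplitude \<open>P\<close>, which \<open>W\<close>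
    forbids.\<close>
  ultimately have "emb p l w \<in> U" using p f(2) by auto
  moreover from this have "p = P" using f(3) p by auto
  moreover have "snd (emb p l w) 0 = p"
    using scaled_solution_nontrivial(2)[OF sol] \<open>p = P\<close> P by simp
  ultimately show False using UV(6) unfolding W_def by auto
qed

lemma lambda1_in_branch: "(lambda1 N a, zeroX) \<in> branch N a g (lambda1 N a)"
  unfolding branch_def using lambda1_in_closure zeroX_mem
  by (simp add: connected_component_of_refl mspace_RXplus)

lemma branch_subset: "branch N a g l \<subseteq> mspace RXplus"
  using connected_component_of_subset_topspace unfolding branch_def by fastforce

lemma branch_unbounded: "\<not> bounded_RXplus (branch N a g (lambda1 N a))"
proof
  let ?x = "(lambda1 N a, zeroX)"
  assume "bounded_RXplus (branch N a g (lambda1 N a))"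
  then obtain B where B: "\<And>z. z \<in> branch N a g (lambda1 N a) \<Longrightarrow> mdist RXplus ?x z \<le> B"
    using lambda1_in_branch unfolding bounded_RXplus_def Metric_space.mbounded_alt[OF Metric_space_mspace_mdist]
    by blast
  \<comment> \<open>The amplitude \<open>max 0 B + 1\<close> is positive, as
    \<open>branch_meets_sphere\<close> requires, and exceeds the supposed bound \<open>B\<close> on
    distances.\<close>
  obtain z where z: "z \<in> branch N a g (lambda1 N a)" "snd z 0 = max 0 B + 1"
    by (rule branch_meets_sphere[of "max 0 B + 1"]) auto
  have mem: "snd z \<in> mspace Xplus"
    using subsetD[OF branch_subset z(1)] by (auto simp: mspace_RXplus)
  have "mdist Xplus zeroX (snd z) \<le> mdist RXplus ?x z"
    by (cases z) (simp add: RXplus_def prod_dist_def)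
  also have "\<dots> \<le> B" by (rule B[OF z(1)])
  finally have "\<bar>zeroX 0 - snd z 0\<bar> \<le> B"
    by (subst (asm) mdist_Xplus_le_iff[OF zeroX_mem mem]) auto
  then show False using z(2) by (simp add: zeroX_def)
qed

end

theorem theorem4p1:
  fixes N :: nat and a g :: "real \<Rightarrow> real"
  assumes N: "N \<ge> 1"
    and a_cont: "continuous_on {0..1} a"
    and a_nonneg: "\<And>r. r \<in> {0..1} \<Longrightarrow> 0 \<le> a r"
    and a_nonzero: "\<And>c d. 0 \<le> c \<Longrightarrow> c < d \<Longrightarrow> d \<le> 1 \<Longrightarrow> \<exists>r\<in>{c..d}. a r \<noteq> 0"
    and g_cont: "continuous_on {0..} g"
    and g_nonneg: "\<And>s. 0 \<le> s \<Longrightarrow> 0 \<le> g s"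
    and g_lim: "((\<lambda>s. g s / s ^ N) \<longlongrightarrow> 0) (at_right 0)"
  shows "bifurcation_point N a g (lambda1 N a) \<and>
    (lambda1 N a, zeroX) \<in> mtopology_of RXplus closure_of branch N a g (lambda1 N a) \<and>
    (\<not> bounded_RXplus (branch N a g (lambda1 N a)) \<or>
     (\<exists>l. eigenvalue N a l \<and> l \<noteq> lambda1 N a \<and> (l, zeroX) \<in> branch N a g (lambda1 N a)))"
proof -
  interpret radial_problem N a g
    by (rule radial_problem.intro) (fact assms)+
  have "(lambda1 N a, zeroX) \<in> mtopology_of RXplus closure_of branch N a g (lambda1 N a)"
    using lambda1_in_branch branch_subset[of "lambda1 N a"]
      closure_of_subset[of "branch N a g (lambda1 N a)" "mtopology_of RXplus"] by auto
  then show ?thesis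
    using lambda1_bifurcation_point branch_unbounded by blast
qed

end
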